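(* Let $m\ge2$ and let $K_1,\dots,K_m\subset\mathbb R^n$ be convex bodies. Then $$|K_1+\cdots+K_m|\ \le\ \binom{mn}{n}\frac{|K_1|\cdots|K_m|}{M(K_1,\dots,K_m)},$$ and, if $M(K_1,\dots,K_m)=\chi_{K_1}\ast\cdots\ast\chi_{K_m}(0)$, then also $$\binom{mn}{n}\frac{|K_1|\cdots|K_m|}{M(K_1,\dots,K_m)}\ \le\ (m-1)^n n^n\,|C_1(K_1,\dots,K_m)|.$$
   Context: A convex body in $\mathbb R^n$ is a compact convex set with non-empty interior; $|\cdot|$ denotes Lebesgue measure; $\chi_K$ is the characteristic function of $K$ and $\ast$ is convolution of functions on $\mathbb R^n$. Put $M(K_1,\dots,K_m)=\max_{x\in\mathbb R^n}\chi_{K_1}\ast\cdots\ast\chi_{K_m}(x)$ and, for $\theta\in[0,1]$, $$K_1+_\theta\cdots+_\theta K_m=\{x\in K_1+\cdots+K_m:\ \chi_{K_1}\ast\cdots\ast\chi_{K_m}(x)\ge\theta M(K_1,\dots,K_m)\},$$ where $K_1+\cdots+K_m$ is the Minkowski sum. When $M(K_1,\dots,K_m)=\chi_{K_1}\ast\cdots\ast\chi_{K_m}(0)$, define $C_1(K_1,\dots,K_m)=\lim_{\theta\to1^-}\frac{K_1+_\theta\cdots+_\theta K_m}{1-\theta}$. The limit exists because the sets $\frac{K_1+_\theta\cdots+_\theta K_m}{1-\theta^{1/((m-1)n)}}$ increase with $\theta$ and $1-\theta\sim(m-1)n\,(1-\theta^{1/((m-1)n)})$ as $\theta\to1^-$;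 that is, $C_1(K_1,\dots,K_m)=\frac1{(m-1)n}\,\overline{\bigcup_{\theta\in(0,1)}\frac{K_1+_\theta\cdots+_\theta K_m}{1-\theta^{1/((m-1)n)}}}$. This set may be unbounded, and its volume may be $+\infty$. *)

theory Defs
  imports "HOL-Analysis.Analysis"
begin

definition convex_body :: "'a::euclidean_space set \<Rightarrow> bool" where
  "convex_body K \<longleftrightarrow> compact K \<and> convex K \<and> interior K \<noteq> {}"

definition convolution :: "('a::euclidean_space \<Rightarrow> real) \<Rightarrow> ('a \<Rightarrow> real) \<Rightarrow> 'a \<Rightarrow> real" where
  "convolution f g x = (LINT y|lborel. f y * g (x - y))"

text \<open>The convolution of the \<open>m\<close> functions \<open>f 0, \<dots>, f (m - 1)\<close>; the value for \<open>m = 0\<close> is a dummy.\<close>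

fun conv_upto :: "(nat \<Rightarrow> 'a::euclidean_space \<Rightarrow> real) \<Rightarrow> nat \<Rightarrow> 'a \<Rightarrow> real" where
  "conv_upto f 0 = (\<lambda>x. 0)"
| "conv_upto f (Suc 0) = f 0"
| "conv_upto f (Suc (Suc k)) = convolution (conv_upto f (Suc k)) (f (Suc k))"

definition chi_conv :: "nat \<Rightarrow> (nat \<Rightarrow> 'a::euclidean_space set) \<Rightarrow> 'a \<Rightarrow> real" where
  "chi_conv m K = conv_upto (\<lambda>i. indicator (K i)) m"

text \<open>\<open>Max\<close> of the library is restricted to finite sets; \<open>GREATEST\<close> is the maximum of an arbitrary
  set that has one.\<close>

definition conv_max :: "nat \<Rightarrow> (nat \<Rightarrow> 'a::euclidean_space set) \<Rightarrow> real" where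
  "conv_max m K = (GREATEST v. v \<in> range (chi_conv m K))"

definition theta_sum :: "real \<Rightarrow> nat \<Rightarrow> (nat \<Rightarrow> 'a::euclidean_space set) \<Rightarrow> 'a set" where
  "theta_sum \<theta> m K = {x \<in> (\<Sum>i<m. K i). chi_conv m K x \<ge> \<theta> * conv_max m K}"

text \<open>Limits of families of (possibly unbounded) sets are taken in the sense of Painleve and
  Kuratowski: the lower and the upper limit agree.\<close>

definition set_lower_limit :: "'b filter \<Rightarrow> ('b \<Rightarrow> 'a::topological_space set) \<Rightarrow> 'a set" where
  "set_lower_limit F A = {x. \<forall>U. open U \<and> x \<in> U \<longrightarrow> (\<forall>\<^sub>F t in F. A t \<inter> U \<noteq> {})}"

definition set_upper_limit :: "'b filter \<Rightarrow> ('b \<Rightarrow> 'a::topological_space set) \<Rightarrow> 'a set" where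
  "set_upper_limit F A = {x. \<forall>U. open U \<and> x \<in> U \<longrightarrow> (\<exists>\<^sub>F t in F. A t \<inter> U \<noteq> {})}"

definition has_set_limit :: "('b \<Rightarrow> 'a::topological_space set) \<Rightarrow> 'a set \<Rightarrow> 'b filter \<Rightarrow> bool" where
  "has_set_limit A C F \<longleftrightarrow> set_lower_limit F A = C \<and> set_upper_limit F A = C"

definition set_limit :: "'b filter \<Rightarrow> ('b \<Rightarrow> 'a::topological_space set) \<Rightarrow> 'a set" where
  "set_limit F A = (THE C. has_set_limit A C F)"

definition C1 :: "nat \<Rightarrow> (nat \<Rightarrow> 'a::euclidean_space set) \<Rightarrow> 'a set" where
  "C1 m K = set_limit (at_left 1) (\<lambda>\<theta>. (\<lambda>x. x /\<^sub>R (1 - \<theta>)) ` theta_sum \<theta> m K)"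

lemma set_limit_eq: "has_set_limit A C F \<Longrightarrow> set_limit F A = C"
  unfolding set_limit_def by (rule the_equality) (auto simp: has_set_limit_def)

lemma has_set_limit_rescaled_mono:
  fixes A B :: "real \<Rightarrow> 'a::real_normed_vector set" and c :: "real \<Rightarrow> real"
  assumes lim: "(c \<longlongrightarrow> c0) (at_left 1)" and c0: "c0 > 0"
    and AB: "\<And>t. 0 < t \<Longrightarrow> t < 1 \<Longrightarrow> A t = (\<lambda>x. c t *\<^sub>R x) ` B t"
    and mono: "\<And>s t. 0 < s \<Longrightarrow> s \<le> t \<Longrightarrow> t < 1 \<Longrightarrow> B s \<subseteq> B t"
  shows "has_set_limit A ((\<lambda>x. c0 *\<^sub>R x) ` closure (\<Union>t\<in>{0<..<1}. B t)) (at_left 1)"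
proof -
  let ?F = "at_left (1::real)"
  let ?C = "(\<lambda>x. c0 *\<^sub>R x) ` closure (\<Union>t\<in>{0<..<1}. B t)"
  have ev: "\<forall>\<^sub>F t in ?F. s < t \<and> t < 1" if "s < 1" for s :: real
    using eventually_at_left_real[OF that] by (auto elim: eventually_mono)
  have lower: "?C \<subseteq> set_lower_limit ?F A"
    unfolding set_lower_limit_def
  proof safe
    fix x U assume x: "x \<in> closure (\<Union>t\<in>{0<..<1}. B t)" and U: "open U" "c0 *\<^sub>R x \<in> U"
    have "open ((\<lambda>x. c0 *\<^sub>R x) -` U)" using U by (intro open_vimage continuous_intros)
    then have "(\<Union>t\<in>{0<..<1}. B t) \<inter> (\<lambda>x. c0 *\<^sub>R x) -` U \<noteq> {}"
      using x U open_Int_closure_eq_empty[of "(\<lambda>x. c0 *\<^sub>R x) -` U" "\<Union>t\<in>{0<..<1}. B t"] by blast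
    then obtain s y where s: "0 < s" "s < 1" and y: "y \<in> B s" "c0 *\<^sub>R y \<in> U" by auto
    have "((\<lambda>t. c t *\<^sub>R y) \<longlongrightarrow> c0 *\<^sub>R y) ?F" by (intro tendsto_intros lim)
    then have "\<forall>\<^sub>F t in ?F. c t *\<^sub>R y \<in> U" using U y by (simp add: tendsto_def)
    with ev[OF s(2)] show "\<forall>\<^sub>F t in ?F. A t \<inter> U \<noteq> {}"
    proof eventually_elim
      case (elim t)
      then have "y \<in> B t" using mono[of s t] s y by auto
      then have "c t *\<^sub>R y \<in> A t" using AB[of t] elim s by auto
      then show ?case using elim by blast
    qed
  qed
  have upper: "set_upper_limit ?F A \<subseteq> ?C"
  proof
    fix x assume x: "x \<in> set_upper_limit ?F A"
    have "x /\<^sub>R c0 \<in> closure (\<Union>t\<in>{0<..<1}. B t)"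
      unfolding closure_iff_nhds_not_empty
    proof (intro allI impI)
      fix S V :: "'a set"
      assume V: "V \<subseteq> S" "open V" "x /\<^sub>R c0 \<in> V"
      have "((\<lambda>p. snd p /\<^sub>R fst p) \<longlongrightarrow> x /\<^sub>R c0) (nhds c0 \<times>\<^sub>F nhds x)"
        using c0 by (intro tendsto_intros filterlim_fst filterlim_snd) auto
      then have "\<forall>\<^sub>F p in nhds c0 \<times>\<^sub>F nhds x. snd p /\<^sub>R fst p \<in> V"
        using V by (simp add: tendsto_def)
      then obtain P Q where P: "eventually P (nhds c0)" and Q: "eventually Q (nhds x)"
        and PQ: "\<And>a b. P a \<Longrightarrow> Q b \<Longrightarrow> b /\<^sub>R a \<in> V"
        unfolding eventually_prod_filter by auto
      from Q obtain U where U: "open U" "x \<in> U" "\<And>b. b \<in> U \<Longrightarrow> Q b"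
        unfolding eventually_nhds by auto
      have 1: "\<exists>\<^sub>F t in ?F. A t \<inter> U \<noteq> {}" using x U by (auto simp: set_upper_limit_def)
      have 2: "\<forall>\<^sub>F t in ?F. P (c t)" using P lim by (simp add: filterlim_iff)
      have 3: "\<forall>\<^sub>F t in ?F. c t > 0" using order_tendstoD(1)[OF lim c0] .
      have "\<exists>\<^sub>F t in ?F. A t \<inter> U \<noteq> {} \<and> P (c t) \<and> c t > 0 \<and> 0 < t \<and> t < 1"
        using 1 eventually_conj[OF 2 eventually_conj[OF 3 ev[of 0]]]
        by (simp add: frequently_eventually_frequently)
      then obtain t where t: "A t \<inter> U \<noteq> {}" "P (c t)" "c t > 0" "0 < t" "t < 1"
        using frequently_ex by blast
      then obtain y where y: "y \<in> B t" "c t *\<^sub>R y \<in> U" using AB[of t] by auto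
      have "(c t *\<^sub>R y) /\<^sub>R c t \<in> V" using PQ t U y by blast
      then have "y \<in> V" using t by simp
      moreover have "y \<in> (\<Union>t\<in>{0<..<1}. B t)" using y t by auto
      ultimately show "(\<Union>t\<in>{0<..<1}. B t) \<inter> S \<noteq> {}" using V by blast
    qed
    moreover have "x = c0 *\<^sub>R (x /\<^sub>R c0)" using c0 by simp
    ultimately show "x \<in> ?C" by blast
  qed
  have "set_lower_limit ?F A \<subseteq> set_upper_limit ?F A"
    unfolding set_lower_limit_def set_upper_limit_def
    by (auto intro!: eventually_frequently)
  with lower upper show ?thesis unfolding has_set_limit_def by blast
qed

lemma C1_eq_closure_Union:
  fixes K :: "nat \<Rightarrow> (real ^ 'n) set" and m :: nat
  defines "p \<equiv> (real m - 1) * real CARD('n)"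
  defines "B \<equiv> (\<lambda>\<theta>. (\<lambda>x. x /\<^sub>R (1 - \<theta> powr (1 / p))) ` theta_sum \<theta> m K)"
  assumes m: "m \<ge> 2"
    and mono: "\<And>s t. 0 < s \<Longrightarrow> s \<le> t \<Longrightarrow> t < 1 \<Longrightarrow> B s \<subseteq> B t"
  shows "C1 m K = (\<lambda>x. x /\<^sub>R p) ` closure (\<Union>\<theta>\<in>{0<..<1}. B \<theta>)"
proof -
  have p: "p > 0" using m by (auto simp: p_def)
  let ?g = "\<lambda>\<theta>::real. 1 - \<theta> powr (1 / p)"
  have "(?g has_real_derivative - (1 / p)) (at 1)"
    by (auto intro!: derivative_eq_intros)
  then have "((\<lambda>t. (?g t - ?g 1) / (t - 1)) \<longlongrightarrow> - (1 / p)) (at_left 1)"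
    unfolding has_field_derivative_iff by (rule tendsto_mono[rotated]) (simp add: at_le)
  from tendsto_minus[OF this]
  have lim: "((\<lambda>t. - ((?g t - ?g 1) / (t - 1))) \<longlongrightarrow> inverse p) (at_left 1)"
    by (simp add: inverse_eq_divide)
  have "(\<lambda>x. x /\<^sub>R (1 - t)) ` theta_sum t m K = (\<lambda>x. - ((?g t - ?g 1) / (t - 1)) *\<^sub>R x) ` B t"
    if t: "0 < t" "t < 1" for t
  proof -
    have "t powr (1 / p) < 1 powr (1 / p)" using t p by (intro powr_less_mono2) auto
    then have "t powr (1 / p) \<noteq> 1" by simp
    then have "- ((?g t - ?g 1) / (t - 1)) * inverse (?g t) = inverse (1 - t)"
      using t by (simp add: divide_simps)
    then show ?thesis unfolding B_def image_image scaleR_scaleR by simp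
  qed
  from has_set_limit_rescaled_mono[OF lim _ this mono] show ?thesis
    unfolding C1_def using p by (intro set_limit_eq) auto
qed

end

theory Submission
  imports Defs
begin

text \<open>Put \<open>p = (m - 1) n\<close>, let \<open>h\<close> be the convolution of the characteristic functions, \<open>M\<close> its maximum,
  attained at \<open>x0\<close>, and \<open>A t = {h \<ge> t M}\<close>. By the Prekopa-Leindler inequality, each convolution with
  the characteristic function of a convex body in dimension \<open>n\<close> turns \<open>1/q\<close>-concavity into
  \<open>1/(q + n)\<close>-concavity, so \<open>h\<close> is \<open>1/p\<close>-concave. Hence \<open>A t - x0\<close>
  contains \<open>1 - t powr (1/p)\<close> times \<open>K 0 + \<dots> + K (m - 1) - x0\<close>, and for \<open>x0 = 0\<close> it is contained in
  \<open>p (1 - t powr (1/p)) C1\<close>. Both inequalities follow from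
  \<open>|K 0| \<cdots> |K (m - 1)| = \<integral> h = M \<integral> |A t| dt\<close> (\<open>t\<close> from \<open>0\<close> to \<open>1\<close>) and the Beta integral
  \<open>\<integral> (1 - t powr (1/p)) ^ n dt = 1 / (mn choose n)\<close>.\<close>

section \<open>Lebesgue measure and integrals\<close>

lemma sets_borel_affine_image:
  fixes S :: "'a::euclidean_space set"
  assumes "S \<in> sets borel" "c \<noteq> 0"
  shows "(\<lambda>x. c *\<^sub>R x + d) ` S \<in> sets borel"
proof -
  have "(\<lambda>x. c *\<^sub>R x + d) ` S = (\<lambda>y. (y - d) /\<^sub>R c) -` S \<inter> space borel"
    using assms(2) by (auto simp: image_iff intro!: bexI[of _ "(_ - d) /\<^sub>R c"])
  also have "\<dots> \<in> sets borel"
    by (rule measurable_sets[OF _ assms(1)]) measurable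
  finally show ?thesis .
qed

lemma emeasure_lborel_affine_image:
  fixes S :: "'a::euclidean_space set"
  assumes "S \<in> sets borel" "c \<noteq> 0"
  shows "emeasure lborel ((\<lambda>x. c *\<^sub>R x + d) ` S) = ennreal (\<bar>c\<bar> ^ DIM('a)) * emeasure lborel S"
  using emeasure_lebesgue_affine[of c d S] sets_borel_affine_image[OF assms, of d] assms(1)
  by simp

text \<open>Tonelli for the region between 0 and the graph of \<open>f\<close>: slicing it
  vertically gives the left-hand side, horizontally the right-hand side. Negative values are cut off
  by \<open>ennreal\<close> on one side and by \<open>t > 0\<close> on the other.\<close>

lemma nn_integral_layer_cake:
  fixes f :: "'a::euclidean_space \<Rightarrow> real"
  assumes [measurable]: "f \<in> borel_measurable borel"
  shows "(\<integral>\<^sup>+x. ennreal (f x) \<partial>lborel)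
    = (\<integral>\<^sup>+t. emeasure lborel {x. t \<le> f x} * indicator {0<..} t \<partial>lborel)"
proof -
  have "ennreal (f x) = (\<integral>\<^sup>+t. indicator {t. 0 < t \<and> t \<le> f x} t \<partial>lborel)" for x
  proof -
    have eq: "{t. 0 < t \<and> t \<le> f x} = {0<..f x}" by auto
    show ?thesis
      unfolding eq by (cases "0 \<le> f x") (auto simp: ennreal_neg)
  qed
  then have "(\<integral>\<^sup>+x. ennreal (f x) \<partial>lborel)
      = (\<integral>\<^sup>+x. (\<integral>\<^sup>+t. indicator {t. 0 < t \<and> t \<le> f x} t \<partial>lborel) \<partial>lborel)" by simp
  also have "\<dots> = (\<integral>\<^sup>+t. (\<integral>\<^sup>+x. indicator {t. 0 < t \<and> t \<le> f x} t \<partial>lborel) \<partial>lborel)"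
    by (rule lborel_pair.Fubini'[symmetric]) (simp add: indicator_def, measurable)
  also have "\<dots> = (\<integral>\<^sup>+t. (\<integral>\<^sup>+x. indicator {0<..} t * indicator {x. t \<le> f x} x \<partial>lborel) \<partial>lborel)"
    by (intro nn_integral_cong) (auto simp: indicator_def)
  also have "\<dots> = (\<integral>\<^sup>+t. emeasure lborel {x. t \<le> f x} * indicator {0<..} t \<partial>lborel)"
    by (intro nn_integral_cong) (subst nn_integral_cmult, auto simp: mult.commute)
  finally show ?thesis .
qed

text \<open>For compact sets the translates of \<open>A\<close> by \<open>min B\<close> and of
  \<open>B\<close> by \<open>max A\<close> both lie in \<open>A + B\<close> and share only the point
  \<open>max A + min B\<close>, so their lengths add up. Inner regularity reduces to this case. The
  set \<open>C\<close> stands in for \<open>A + B\<close>, which need not be Borel.\<close>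

lemma brunn_minkowski_real:
  fixes A B C :: "real set"
  assumes A: "A \<in> sets borel" "bounded A" "A \<noteq> {}"
    and B: "B \<in> sets borel" "bounded B" "B \<noteq> {}"
    and C: "C \<in> sets borel" and ABC: "\<And>x y. x \<in> A \<Longrightarrow> y \<in> B \<Longrightarrow> x + y \<in> C"
  shows "emeasure lborel A + emeasure lborel B \<le> emeasure lborel C"
proof (rule ennreal_le_epsilon)
  fix e :: real assume e: "0 < e"
  have inner: "\<exists>S. compact S \<and> S \<noteq> {} \<and> S \<subseteq> D \<and> emeasure lborel D \<le> emeasure lborel S + ennreal (e / 2)"
    if D: "D \<in> sets borel" "bounded D" "D \<noteq> {}" for D :: "real set"
  proof -
    \<comment> \<open>Inner regularity may return the empty set; adding the point \<open>a\<close>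
      guarantees that the maximum and the minimum taken below exist.\<close>
    obtain a where a: "a \<in> D" using D by auto
    obtain T where T: "closed T" "T \<subseteq> D" "emeasure lebesgue (D - T) < ennreal (e / 2)"
      using sets_lebesgue_inner_closed[of D "e / 2"] D(1) e by (metis half_gt_zero sets_completionI_sets sets_lborel)
    have "emeasure lborel D \<le> emeasure lborel (T \<union> (D - T))"
      using T D by (intro emeasure_mono) auto
    also have "\<dots> \<le> emeasure lborel T + emeasure lborel (D - T)"
      using T D by (intro emeasure_subadditive) auto
    also have "\<dots> \<le> emeasure lborel (insert a T) + ennreal (e / 2)"
      using T D by (intro add_mono emeasure_mono) auto
    finally have "emeasure lborel D \<le> emeasure lborel (insert a T) + ennreal (e / 2)" .
    moreover have "compact (insert a T)"
      using T D by (meson bounded_subset closed_insert compact_eq_bounded_closed insert_subset a)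
    ultimately show ?thesis using a T by (intro exI[of _ "insert a T"]) auto
  qed
  from inner[OF A] obtain A' where A': "compact A'" "A' \<noteq> {}" "A' \<subseteq> A"
    "emeasure lborel A \<le> emeasure lborel A' + ennreal (e / 2)" by auto
  from inner[OF B] obtain B' where B': "compact B'" "B' \<noteq> {}" "B' \<subseteq> B"
    "emeasure lborel B \<le> emeasure lborel B' + ennreal (e / 2)" by auto
  obtain M where M: "M \<in> A'" "\<And>x. x \<in> A' \<Longrightarrow> x \<le> M" using compact_attains_sup[OF A'(1,2)] by auto
  obtain m where m: "m \<in> B'" "\<And>x. x \<in> B' \<Longrightarrow> m \<le> x" using compact_attains_inf[OF B'(1,2)] by auto
  define X where "X = (\<lambda>x. 1 *\<^sub>R x + m) ` A'"
  define Y where "Y = (\<lambda>x. 1 *\<^sub>R x + M) ` B'"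
  have A'b: "A' \<in> sets borel" and B'b: "B' \<in> sets borel" using A' B' by (auto simp: borel_compact)
  have Xb: "X \<in> sets borel" and Yb: "Y \<in> sets borel"
    unfolding X_def Y_def by (intro sets_borel_affine_image A'b B'b; simp)+
  have "emeasure lborel A' + emeasure lborel B' = emeasure lborel X + emeasure lborel Y"
    unfolding X_def Y_def using A'b B'b by (subst (1 2) emeasure_lborel_affine_image) auto
  \<comment> \<open>\<open>X\<close> lies to the left of \<open>M + m\<close> and \<open>Y\<close>
    to the right; removing this null set makes them disjoint.\<close>
  also have "emeasure lborel X = emeasure lborel (X - {M + m})"
    using Xb by (intro emeasure_Diff_null_set[symmetric]) auto
  also have "\<dots> + emeasure lborel Y = emeasure lborel ((X - {M + m}) \<union> Y)"
  proof (rule plus_emeasure)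
    show "(X - {M + m}) \<inter> Y = {}"
      unfolding X_def Y_def using M(2) m(2) by fastforce
  qed (use Xb Yb in auto)
  also have "\<dots> \<le> emeasure lborel C"
    using ABC[OF subsetD[OF A'(3)] subsetD[OF B'(3)]] M(1) m(1) C
    by (intro emeasure_mono) (auto simp: X_def Y_def add.commute[of _ M])
  finally have *: "emeasure lborel A' + emeasure lborel B' \<le> emeasure lborel C" .
  have "emeasure lborel A + emeasure lborel B
      \<le> (emeasure lborel A' + ennreal (e / 2)) + (emeasure lborel B' + ennreal (e / 2))"
    by (intro add_mono A' B')
  also have "\<dots> = (emeasure lborel A' + emeasure lborel B') + ennreal e"
    using e by (simp add: add_ac flip: ennreal_plus)
  also have "\<dots> \<le> emeasure lborel C + ennreal e" using * by (intro add_mono) auto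
  finally show "emeasure lborel A + emeasure lborel B \<le> emeasure lborel C + ennreal e" .
qed

lemma weighted_am_gm:
  fixes a b u :: real
  assumes "0 < u" "u < 1" "0 \<le> a" "0 \<le> b"
  shows "a powr u * b powr (1 - u) \<le> u * a + (1 - u) * b"
  using Youngs_inequality_0[of u "1 - u" a b] assms by (cases "a = 0 \<or> b = 0") auto

text \<open>The function \<open>t * (1 - t powr (1 / p)) ^ Suc n\<close> vanishes at 0 and at 1, so
  its derivative integrates to 0. This expresses the integral for \<open>Suc n\<close> as
  \<open>Suc n / (p + Suc n)\<close> times the one for \<open>n\<close>. The derivative is taken in
  the open interval only, since the root may fail to be differentiable at 0.\<close>

lemma power_beta_integral:
  fixes p :: real and n :: nat
  assumes "p > 0"
  shows "((\<lambda>t. (1 - t powr (1 / p)) ^ n) has_integral (\<Prod>k=1..n. real k / (p + real k))) {0..1}"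
proof (induction n)
  case 0
  show ?case using has_integral_const_real[of "1::real" 0 1] by simp
next
  case (Suc n)
  let ?w = "\<lambda>t::real. t powr (1 / p)"
  let ?N = "real (Suc n)"
  let ?G = "\<lambda>t. t * (1 - ?w t) ^ Suc n"
  let ?g = "\<lambda>t. (1 + ?N / p) * (1 - ?w t) ^ Suc n - (?N / p) * (1 - ?w t) ^ n"
  have w: "continuous_on {0..1} ?w"
    using assms by (intro continuous_on_powr') (auto intro!: continuous_intros)
  have "(?g has_integral (?G 1 - ?G 0)) {0..1}"
  proof (rule fundamental_theorem_of_calculus_interior)
    show "continuous_on {0..1} ?G" by (intro continuous_intros w)
    fix t :: real assume t: "t \<in> {0<..<1}"
    have tw: "t * (t powr (1 / p - 1)) = t powr (1 / p)"
      using t by (simp add: powr_diff)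
    have "(?G has_real_derivative
        (1 - ?w t) ^ Suc n + t * (?N * (1 - ?w t) ^ n * (- ((1 / p) * t powr (1 / p - 1))))) (at t)"
      using t by (auto intro!: derivative_eq_intros simp: mult_ac simp del: power_Suc)
    also have "(1 - ?w t) ^ Suc n + t * (?N * (1 - ?w t) ^ n * (- ((1 / p) * t powr (1 / p - 1))))
        = (1 - ?w t) ^ Suc n - (?N / p) * (1 - ?w t) ^ n * (t * t powr (1 / p - 1))"
      by (simp add: field_simps)
    also have "\<dots> = ?g t"
      unfolding tw by (simp add: algebra_simps)
    finally show "(?G has_vector_derivative ?g t) (at t)"
      by (simp add: has_real_derivative_iff_has_vector_derivative)
  qed simp
  then have "(?g has_integral 0) {0..1}" by simp
  from has_integral_add[OF this has_integral_mult_right[OF Suc.IH, of "?N / p"]]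
  have "((\<lambda>t. (1 + ?N / p) * (1 - ?w t) ^ Suc n) has_integral
      ?N / p * (\<Prod>k=1..n. real k / (p + real k))) {0..1}" by simp
  note int = has_integral_mult_right[OF this, of "p / (p + ?N)"]
  have pN: "p + ?N > 0" using assms by (simp add: add_pos_pos)
  have 1: "p / (p + ?N) * (1 + ?N / p) = 1"
    using assms pN by (simp add: divide_simps del: of_nat_Suc)
  have 2: "p / (p + ?N) * (?N / p) = ?N / (p + ?N)" using assms by simp
  have 3: "(\<Prod>k=1..Suc n. real k / (p + real k)) = ?N / (p + ?N) * (\<Prod>k=1..n. real k / (p + real k))"
    by (simp add: prod.nat_ivl_Suc')
  show ?case
    using int unfolding mult.assoc[symmetric] 1 2 3 mult_1_left .
qed

text \<open>The induction step is the absorption identity for binomial coefficients.\<close>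

lemma prod_fraction_eq_inverse_binomial:
  "(\<Prod>k=1..n. real k / (real p + real k)) = 1 / real ((p + n) choose n)"
proof (induction n)
  case (Suc n)
  have "real (Suc n) * real ((p + Suc n) choose Suc n) = real (p + Suc n) * real ((p + n) choose n)"
    using Suc_times_binomial_eq[of "p + n" n] unfolding of_nat_mult[symmetric] of_nat_eq_iff
    by (simp only: add_Suc_right mult.commute)
  moreover have "real ((p + Suc n) choose Suc n) > 0" "real ((p + n) choose n) > 0"
    by (simp_all del: binomial_Suc_Suc add_Suc_right)
  ultimately have "real (Suc n) / real (p + Suc n) / real ((p + n) choose n) = 1 / real ((p + Suc n) choose Suc n)"
    by (simp add: divide_simps mult.commute del: of_nat_Suc of_nat_add)
  then show ?case using Suc
    by (simp add: prod.nat_ivl_Suc' mult.commute del: binomial_Suc_Suc add_Suc_right)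
qed simp

lemma nn_integral_power_beta:
  assumes p: "0 < p"
  shows "(\<integral>\<^sup>+t. ennreal ((1 - t powr (1 / real p)) ^ n) * indicator {0..1} t \<partial>lborel)
    = ennreal (1 / real ((p + n) choose n))"
proof -
  have "0 \<le> (1 - t powr (1 / real p)) ^ n" if "t \<in> {0..1}" for t :: real
    using that by (auto intro!: zero_le_power powr_le1)
  from nn_integral_has_integral_lebesgue'[OF this power_beta_integral[of "real p" n]]
  show ?thesis using p prod_fraction_eq_inverse_binomial[of p n] by simp
qed

section \<open>The Prekopa-Leindler inequality\<close>

text \<open>A bound together with a support of finite measure makes all integrals finite and is
  inherited by sections and marginals. The conditions are relative to \<open>space M\<close> because
  the points of a product measure are extensional functions.\<close>

definition bounded_on_support :: "'a measure \<Rightarrow> 'a set \<Rightarrow> real \<Rightarrow> ('a \<Rightarrow> real) \<Rightarrow> bool" where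
  "bounded_on_support M S c f \<longleftrightarrow> f \<in> borel_measurable M \<and> S \<in> fmeasurable M \<and>
    (\<forall>x\<in>space M. 0 \<le> f x \<and> f x \<le> c \<and> (x \<notin> S \<longrightarrow> f x = 0))"

lemma bounded_on_supportD:
  assumes "bounded_on_support M S c f"
  shows "f \<in> borel_measurable M" "S \<in> fmeasurable M" "\<And>x. x \<in> space M \<Longrightarrow> 0 \<le> f x"
    "\<And>x. x \<in> space M \<Longrightarrow> f x \<le> c" "\<And>x. x \<in> space M \<Longrightarrow> x \<notin> S \<Longrightarrow> f x = 0"
  using assms by (auto simp: bounded_on_support_def)

lemma bounded_on_support_integrable:
  assumes "bounded_on_support M S c f"
  shows "integrable M f"
proof (rule Bochner_Integration.integrable_bound)
  note D = bounded_on_supportD[OF assms]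
  show "integrable M (\<lambda>x. c * indicator S x)"
    using D(2) by (auto simp: fmeasurable_def top.not_eq_extremum)
  show "AE x in M. norm (f x) \<le> norm (c * indicator S x)"
    using D(3-5) by (intro AE_I2) (force simp: indicator_def)
qed (rule bounded_on_supportD[OF assms])

lemma bounded_on_support_integral_bounds:
  assumes f: "bounded_on_support M S c f"
  shows "0 \<le> integral\<^sup>L M f" "integral\<^sup>L M f \<le> c * measure M S"
proof -
  note D = bounded_on_supportD[OF f]
  show "0 \<le> integral\<^sup>L M f" using D(3) by (intro Bochner_Integration.integral_nonneg) auto
  have "integral\<^sup>L M f \<le> (\<integral>x. c * indicator S x \<partial>M)"
  proof (intro Bochner_Integration.integral_mono bounded_on_support_integrable[OF f])
    show "integrable M (\<lambda>x. c * indicator S x)"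
      using D(2) by (auto simp: fmeasurable_def top.not_eq_extremum)
  qed (use D(3-5) in \<open>force simp: indicator_def\<close>)
  also have "\<dots> = c * measure M S"
    using D(2) by (simp add: Int_absorb1 fmeasurableD sets.sets_into_space)
  finally show "integral\<^sup>L M f \<le> c * measure M S" .
qed

lemma nn_integral_divide_eq:
  assumes f: "bounded_on_support M S c f" and "a > 0"
  shows "(\<integral>\<^sup>+x. ennreal (f x / a) \<partial>M) = ennreal (integral\<^sup>L M f / a)"
proof -
  note D = bounded_on_supportD[OF f]
  have "(\<integral>\<^sup>+x. ennreal (f x / a) \<partial>M) = ennreal (\<integral>x. f x / a \<partial>M)"
    using bounded_on_support_integrable[OF f] D(3) \<open>a > 0\<close>
    by (intro nn_integral_eq_integral) auto
  then show ?thesis by simp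
qed

text \<open>Divide \<open>f\<close> and \<open>g\<close> by their suprema, so that their level sets
  are nonempty at the same heights \<open>t < 1\<close>. Brunn-Minkowski on the line compares these
  with the level sets of \<open>h\<close>, and integrating over \<open>t\<close> gives the
  inequality with an arithmetic mean on the left. The AM-GM inequality then yields the geometric
  mean.\<close>

lemma prekopa_leindler_real:
  fixes f g h :: "real \<Rightarrow> real"
  assumes u: "0 < u" "u < 1" and S: "bounded S"
    and f: "bounded_on_support lborel S C f" and g: "bounded_on_support lborel S C g"
    and h: "bounded_on_support lborel S' C' h"
    and le: "\<And>x y. f x powr u * g y powr (1 - u) \<le> h (u * x + (1 - u) * y)"
  shows "(\<integral>x. f x \<partial>lborel) powr u * (\<integral>x. g x \<partial>lborel) powr (1 - u) \<le> (\<integral>x. h x \<partial>lborel)"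
proof (cases "(\<integral>x. f x \<partial>lborel) = 0 \<or> (\<integral>x. g x \<partial>lborel) = 0")
  \<comment> \<open>Here the left-hand side is 0, because \<open>0 powr u\<close> is 0.\<close>
  case True
  then show ?thesis using bounded_on_support_integral_bounds[OF h] by auto
next
  case False
  have pos: "0 < (SUP x. k x)" and bdd: "bdd_above (range k)"
    if k: "bounded_on_support lborel S C k" "(\<integral>x. k x \<partial>lborel) \<noteq> 0" for k
  proof -
    note D = bounded_on_supportD[OF k(1)]
    show b: "bdd_above (range k)" using D(4) by (intro bdd_aboveI[of _ C]) auto
    have "\<exists>x. k x \<noteq> 0" using k(2) by (metis Bochner_Integration.integral_zero ext)
    then obtain x where "k x > 0" using D(3) by (metis less_eq_real_def space_lborel UNIV_I space_borel)
    then show "0 < (SUP x. k x)" using cSUP_upper[OF UNIV_I b, of x] by linarith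
  qed
  note F = bounded_on_supportD[OF f] and G = bounded_on_supportD[OF g] and H = bounded_on_supportD[OF h]
  have [measurable]: "f \<in> borel_measurable borel" "g \<in> borel_measurable borel" "h \<in> borel_measurable borel"
    using F(1) G(1) H(1) by auto
  define a where "a = (SUP x. f x)"
  define b where "b = (SUP x. g x)"
  have a: "a > 0" "bdd_above (range f)" and b: "b > 0" "bdd_above (range g)"
    using pos bdd f g False by (auto simp: a_def b_def)
  \<comment> \<open>With this scale \<open>t * c\<close> is the weighted geometric mean of
    \<open>t * a\<close> and \<open>t * b\<close>, so level \<open>t\<close> of \<open>f / a\<close>
    and \<open>g / b\<close> is sent to level \<open>t\<close> of \<open>h / c\<close>.\<close>
  define c where "c = a powr u * b powr (1 - u)"
  have c: "c > 0" using a b by (simp add: c_def)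
  let ?A = "\<lambda>t. {x. t \<le> f x / a}" and ?B = "\<lambda>t. {x. t \<le> g x / b}" and ?H = "\<lambda>t. {x. t \<le> h x / c}"
  have fa: "f x / a \<le> 1" and gb: "g x / b \<le> 1" for x
    using cSUP_upper[OF UNIV_I a(2), of x] cSUP_upper[OF UNIV_I b(2), of x] a b
    by (auto simp: a_def b_def)
  \<comment> \<open>At \<open>t = 1\<close> only one of the two suprema may be attained, and
    Brunn-Minkowski does not apply when one set is empty; this single level is a null set for the
    integration.\<close>
  have level: "ennreal u * emeasure lborel (?A t) + ennreal (1 - u) * emeasure lborel (?B t)
      \<le> emeasure lborel (?H t)" if t: "0 < t" "t \<noteq> 1" for t
  proof (cases "t < 1")
    case False
    have "t > f x / a" "t > g x / b" for x using fa[of x] gb[of x] False t(2) by linarith+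
    then have "?A t = {}" "?B t = {}" by (auto simp: not_le)
    then show ?thesis by simp
  next
    case True
    have "t * a < a" "t * b < b" using True a b by auto
    then obtain x0 y0 where "t * a < f x0" "t * b < g y0"
      unfolding a_def b_def using less_cSUP_iff[OF UNIV_not_empty a(2)] less_cSUP_iff[OF UNIV_not_empty b(2)]
      by auto
    then have ne: "?A t \<noteq> {}" "?B t \<noteq> {}" using a b by (auto simp: field_simps intro!: less_imp_le)
    have "?A t \<subseteq> S" "?B t \<subseteq> S"
      using F(5) G(5) t(1) by force+
    then have bd: "bounded (?A t)" "bounded (?B t)" using S by (auto intro: bounded_subset)
    have m[measurable]: "?A t \<in> sets borel" "?B t \<in> sets borel" "?H t \<in> sets borel" by measurable
    let ?uA = "(\<lambda>x. u *\<^sub>R x + 0) ` ?A t" and ?uB = "(\<lambda>x. (1 - u) *\<^sub>R x + 0) ` ?B t"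
    have "emeasure lborel ?uA + emeasure lborel ?uB \<le> emeasure lborel (?H t)"
    proof (rule brunn_minkowski_real)
      show "?uA \<in> sets borel" "?uB \<in> sets borel"
        using u m by (intro sets_borel_affine_image; simp)+
      show "bounded ?uA" "bounded ?uB" using bd by (auto intro!: bounded_scaling simp del: real_scaleR_def)
      show "?uA \<noteq> {}" "?uB \<noteq> {}" using ne by auto
      fix x y assume "x \<in> ?uA" "y \<in> ?uB"
      then obtain x' y' where x: "x = u * x'" "t * a \<le> f x'" and y: "y = (1 - u) * y'" "t * b \<le> g y'"
        using a b by (auto simp: pos_le_divide_eq)
      have "t * c = t powr u * t powr (1 - u) * c" using t by (simp flip: powr_add)
      also have "\<dots> = (t * a) powr u * (t * b) powr (1 - u)"
        using t a b by (simp add: powr_mult c_def)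
      also have "\<dots> \<le> f x' powr u * g y' powr (1 - u)"
        using x y t a b u by (intro mult_mono powr_mono2) auto
      also have "\<dots> \<le> h (x + y)" using le[of x' y'] x y by simp
      finally show "x + y \<in> ?H t" using c by (simp add: field_simps)
    qed (fact m)
    then show ?thesis
      using u m by (subst (asm) (1 2) emeasure_lborel_affine_image) auto
  qed
  have "ennreal u * (\<integral>\<^sup>+x. ennreal (f x / a) \<partial>lborel) + ennreal (1 - u) * (\<integral>\<^sup>+x. ennreal (g x / b) \<partial>lborel)
      = (\<integral>\<^sup>+t. ennreal u * (emeasure lborel (?A t) * indicator {0<..} t)
          + ennreal (1 - u) * (emeasure lborel (?B t) * indicator {0<..} t) \<partial>lborel)"
    by (simp add: nn_integral_layer_cake nn_integral_add nn_integral_cmult)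
  also have "\<dots> \<le> (\<integral>\<^sup>+t. emeasure lborel (?H t) * indicator {0<..} t \<partial>lborel)"
  proof (rule nn_integral_mono_AE)
    have "AE t in lborel. t \<noteq> (1::real)" by (rule AE_lborel_singleton)
    then show "AE t in lborel. ennreal u * (emeasure lborel (?A t) * indicator {0<..} t)
          + ennreal (1 - u) * (emeasure lborel (?B t) * indicator {0<..} t)
        \<le> emeasure lborel (?H t) * indicator {0<..} t"
      by eventually_elim (use level in \<open>auto simp: indicator_def\<close>)
  qed
  also have "\<dots> = (\<integral>\<^sup>+x. ennreal (h x / c) \<partial>lborel)"
    by (simp add: nn_integral_layer_cake)
  finally have "ennreal u * ennreal (integral\<^sup>L lborel f / a) + ennreal (1 - u) * ennreal (integral\<^sup>L lborel g / b)
      \<le> ennreal (integral\<^sup>L lborel h / c)"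
    by (simp only: nn_integral_divide_eq[OF f a(1)] nn_integral_divide_eq[OF g b(1)] nn_integral_divide_eq[OF h c])
  then have *: "u * (integral\<^sup>L lborel f / a) + (1 - u) * (integral\<^sup>L lborel g / b) \<le> integral\<^sup>L lborel h / c"
    using u a b c bounded_on_support_integral_bounds[OF f] bounded_on_support_integral_bounds[OF g]
      bounded_on_support_integral_bounds[OF h]
    by (simp flip: ennreal_mult ennreal_plus)
  have "integral\<^sup>L lborel f powr u * integral\<^sup>L lborel g powr (1 - u) / c
      = (integral\<^sup>L lborel f / a) powr u * (integral\<^sup>L lborel g / b) powr (1 - u)"
    using a b bounded_on_support_integral_bounds[OF f] bounded_on_support_integral_bounds[OF g]
    by (simp add: powr_divide c_def)
  also have "\<dots> \<le> integral\<^sup>L lborel h / c"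
    using * weighted_am_gm[OF u, of "integral\<^sup>L lborel f / a" "integral\<^sup>L lborel g / b"] a b
      bounded_on_support_integral_bounds[OF f] bounded_on_support_integral_bounds[OF g] by force
  finally show ?thesis using c by (simp add: divide_le_cancel)
qed

section \<open>From the line to several dimensions, one coordinate at a time\<close>

lemma fun_upd_in_space_PiM:
  assumes "x \<in> space (\<Pi>\<^sub>M j\<in>I. (lborel :: real measure))"
  shows "x(i := t) \<in> space (\<Pi>\<^sub>M j\<in>insert i I. (lborel :: real measure))"
  using assms by (auto simp: space_PiM PiE_def extensional_def)

lemma bounded_on_support_section:
  assumes f: "bounded_on_support (\<Pi>\<^sub>M j\<in>insert i I. lborel) (PiE (insert i I) (\<lambda>_. {- R..R::real})) C f"
    and x: "x \<in> space (\<Pi>\<^sub>M j\<in>I. lborel)" and i: "i \<notin> I"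
  shows "bounded_on_support lborel {- R..R} C (\<lambda>t. f (x(i := t)))"
  unfolding bounded_on_support_def
proof (intro conjI ballI impI)
  note D = bounded_on_supportD[OF f]
  have "(\<lambda>t. f (x(i := t))) = f \<circ> (\<lambda>t. x(i := t))" by auto
  also have "\<dots> \<in> borel_measurable lborel"
    using x i by (intro measurable_comp[OF _ D(1)] measurable_component_update)
  finally show "(\<lambda>t. f (x(i := t))) \<in> borel_measurable lborel" .
  show "{- R..R} \<in> fmeasurable lborel" by (auto simp: fmeasurable_def emeasure_lborel_Icc_eq)
  fix t :: real
  show "0 \<le> f (x(i := t))" "f (x(i := t)) \<le> C"
    using D(3,4) fun_upd_in_space_PiM[OF x] by auto
  assume "t \<notin> {- R..R}"
  then show "f (x(i := t)) = 0"
    by (intro D(5) fun_upd_in_space_PiM[OF x]) (auto simp: PiE_iff)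
qed

lemma fmeasurable_PiE_Icc:
  assumes "finite I"
  shows "PiE I (\<lambda>_. {a..b::real}) \<in> fmeasurable (\<Pi>\<^sub>M j\<in>I. lborel)"
proof -
  interpret product_sigma_finite "\<lambda>_. lborel :: real measure" by standard
  show ?thesis
    using assms by (intro fmeasurableI sets_PiM_I_finite)
      (auto simp: emeasure_PiM emeasure_lborel_Icc_eq less_top[symmetric] power_eq_top_ennreal)
qed

text \<open>Keeps the class of admissible functions closed under integrating out one coordinate, as
  the induction on the dimension requires; the bound picks up the length \<open>2 * R\<close> of the
  interval.\<close>

lemma bounded_on_support_marginal:
  assumes f: "bounded_on_support (\<Pi>\<^sub>M j\<in>insert i I. lborel) (PiE (insert i I) (\<lambda>_. {- R..R::real})) C f"
    and I: "finite I" "i \<notin> I" and R: "0 \<le> R"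
  shows "bounded_on_support (\<Pi>\<^sub>M j\<in>I. lborel) (PiE I (\<lambda>_. {- R..R})) (C * (2 * R))
    (\<lambda>x. \<integral>t. f (x(i := t)) \<partial>lborel)"
  unfolding bounded_on_support_def
proof (intro conjI ballI impI)
  note D = bounded_on_supportD[OF f]
  have "(\<lambda>(x, t). f (x(i := t))) = f \<circ> (\<lambda>(x, t). x(i := t))" by auto
  also have "\<dots> \<in> borel_measurable ((\<Pi>\<^sub>M j\<in>I. lborel) \<Otimes>\<^sub>M lborel)"
    by (rule measurable_comp[OF measurable_add_dim D(1)])
  finally show "(\<lambda>x. \<integral>t. f (x(i := t)) \<partial>lborel) \<in> borel_measurable (\<Pi>\<^sub>M j\<in>I. lborel)"
    by (rule lborel.borel_measurable_lebesgue_integral)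
  show "PiE I (\<lambda>_. {- R..R}) \<in> fmeasurable (\<Pi>\<^sub>M j\<in>I. lborel)"
    by (rule fmeasurable_PiE_Icc[OF I(1)])
  fix x assume x: "x \<in> space (\<Pi>\<^sub>M j\<in>I. (lborel :: real measure))"
  note s = bounded_on_support_section[OF f x I(2)]
  show "0 \<le> (\<integral>t. f (x(i := t)) \<partial>lborel)" "(\<integral>t. f (x(i := t)) \<partial>lborel) \<le> C * (2 * R)"
    using bounded_on_support_integral_bounds[OF s] R by auto
  assume "x \<notin> PiE I (\<lambda>_. {- R..R})"
  then obtain j where "j \<in> I" "x j \<notin> {- R..R}" using x by (auto simp: space_PiM PiE_iff)
  then have "f (x(i := t)) = 0" for t
    using I(2) by (intro D(5) fun_upd_in_space_PiM[OF x]) (auto simp: PiE_iff)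
  then show "(\<integral>t. f (x(i := t)) \<partial>lborel) = 0" by simp
qed

text \<open>Induction on the set of coordinates. The one-dimensional inequality, applied to sections
  in the new coordinate, says that the marginals of \<open>f\<close>, \<open>g\<close>,
  \<open>h\<close> satisfy the hypothesis in the remaining coordinates; Fubini identifies the
  integrals of the marginals. The bound \<open>C\<close> changes at each step and is therefore
  generalised.\<close>

lemma prekopa_leindler_PiM:
  fixes f g h :: "('i \<Rightarrow> real) \<Rightarrow> real"
  assumes I: "finite I" and u: "0 < u" "u < 1" and R: "0 \<le> R"
    and "bounded_on_support (\<Pi>\<^sub>M j\<in>I. lborel) (PiE I (\<lambda>_. {- R..R})) C f"
    and "bounded_on_support (\<Pi>\<^sub>M j\<in>I. lborel) (PiE I (\<lambda>_. {- R..R})) C g"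
    and "bounded_on_support (\<Pi>\<^sub>M j\<in>I. lborel) (PiE I (\<lambda>_. {- R..R})) C h"
    and "\<And>x y. x \<in> extensional I \<Longrightarrow> y \<in> extensional I \<Longrightarrow>
      f x powr u * g y powr (1 - u) \<le> h (\<lambda>i\<in>I. u * x i + (1 - u) * y i)"
  shows "(\<integral>x. f x \<partial>(\<Pi>\<^sub>M j\<in>I. lborel)) powr u * (\<integral>x. g x \<partial>(\<Pi>\<^sub>M j\<in>I. lborel)) powr (1 - u)
    \<le> (\<integral>x. h x \<partial>(\<Pi>\<^sub>M j\<in>I. lborel))"
  using I assms(5-)
proof (induction I arbitrary: f g h C rule: finite_induct)
  case empty
  \<comment> \<open>Over no coordinates the measure is a unit mass at the everywhere undefined
    function, and the claim is the pointwise hypothesis there.\<close>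
  show ?case using empty(4)[of "\<lambda>_. undefined" "\<lambda>_. undefined"]
    by (simp add: PiM_empty lebesgue_integral_count_space_finite extensional_def restrict_def)
next
  case (insert i I)
  interpret product_sigma_finite "\<lambda>_. lborel :: real measure" by standard
  note f = insert.prems(1) and g = insert.prems(2) and h = insert.prems(3)
  let ?F = "\<lambda>k x. \<integral>t. k (x(i := t)) \<partial>lborel"
  have "(\<integral>x. ?F f x \<partial>(\<Pi>\<^sub>M j\<in>I. lborel)) powr u * (\<integral>x. ?F g x \<partial>(\<Pi>\<^sub>M j\<in>I. lborel)) powr (1 - u)
    \<le> (\<integral>x. ?F h x \<partial>(\<Pi>\<^sub>M j\<in>I. lborel))"
  proof (rule insert.IH)
    show "bounded_on_support (\<Pi>\<^sub>M j\<in>I. lborel) (PiE I (\<lambda>_. {- R..R})) (C * (2 * R)) (?F f)"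
      "bounded_on_support (\<Pi>\<^sub>M j\<in>I. lborel) (PiE I (\<lambda>_. {- R..R})) (C * (2 * R)) (?F g)"
      "bounded_on_support (\<Pi>\<^sub>M j\<in>I. lborel) (PiE I (\<lambda>_. {- R..R})) (C * (2 * R)) (?F h)"
      using insert.hyps R by (intro bounded_on_support_marginal f g h; simp)+
    fix x y :: "'i \<Rightarrow> real" assume x: "x \<in> extensional I" and y: "y \<in> extensional I"
    let ?z = "\<lambda>i\<in>I. u * x i + (1 - u) * y i"
    show "?F f x powr u * ?F g y powr (1 - u) \<le> ?F h ?z"
    proof (rule prekopa_leindler_real[OF u])
      show "bounded_on_support lborel {- R..R} C (\<lambda>t. f (x(i := t)))"
        "bounded_on_support lborel {- R..R} C (\<lambda>t. g (y(i := t)))"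
        "bounded_on_support lborel {- R..R} C (\<lambda>t. h (?z(i := t)))"
        using insert.hyps x y
        by (intro bounded_on_support_section[OF f] bounded_on_support_section[OF g]
            bounded_on_support_section[OF h]; auto simp: space_PiM PiE_iff)+
      fix s t
      have "?z(i := u * s + (1 - u) * t)
          = (\<lambda>j\<in>insert i I. u * (x(i := s)) j + (1 - u) * (y(i := t)) j)"
        using insert.hyps by (auto simp: fun_eq_iff restrict_def)
      moreover have "x(i := s) \<in> extensional (insert i I)" "y(i := t) \<in> extensional (insert i I)"
        using x y by (auto simp: extensional_def)
      ultimately show "f (x(i := s)) powr u * g (y(i := t)) powr (1 - u) \<le> h (?z(i := u * s + (1 - u) * t))"
        using insert.prems(4) by metis
    qed auto
  qed
  then show ?case
    by (simp only: product_integral_insert[OF insert.hyps bounded_on_support_integrable[OF f]]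
        product_integral_insert[OF insert.hyps bounded_on_support_integrable[OF g]]
        product_integral_insert[OF insert.hyps bounded_on_support_integrable[OF h]])
qed

text \<open>\<open>lborel\<close> is the image of a product of Lebesgue measures on the line under
  the linear coordinate map \<open>?e\<close>, and the ball lies in the cube over
  \<open>{- ?R..?R}\<close>.\<close>

theorem prekopa_leindler:
  fixes f g h :: "'a::euclidean_space \<Rightarrow> real"
  assumes u: "0 < u" "u < 1"
    and f: "bounded_on_support lborel (cball 0 R) C f"
    and g: "bounded_on_support lborel (cball 0 R) C g"
    and h: "bounded_on_support lborel (cball 0 R) C h"
    and le: "\<And>x y. f x powr u * g y powr (1 - u) \<le> h (u *\<^sub>R x + (1 - u) *\<^sub>R y)"
  shows "(\<integral>x. f x \<partial>lborel) powr u * (\<integral>x. g x \<partial>lborel) powr (1 - u) \<le> (\<integral>x. h x \<partial>lborel)"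
proof -
  let ?P = "\<Pi>\<^sub>M j\<in>(Basis::'a set). (lborel :: real measure)"
  let ?e = "\<lambda>x. \<Sum>b\<in>(Basis::'a set). x b *\<^sub>R b"
  let ?R = "max R 0"
  have e[measurable]: "?e \<in> measurable ?P borel" by measurable
  have eq: "integral\<^sup>L lborel k = (\<integral>x. k (?e x) \<partial>?P)" if "bounded_on_support lborel (cball 0 R) C k" for k
    using bounded_on_supportD(1)[OF that] by (subst lborel_eq) (intro integral_distr e, simp)
  have b: "bounded_on_support ?P (PiE Basis (\<lambda>_. {- ?R..?R})) C (\<lambda>x. k (?e x))"
    if k: "bounded_on_support lborel (cball 0 R) C k" for k
    unfolding bounded_on_support_def
  proof (intro conjI ballI impI)
    note D = bounded_on_supportD[OF k]
    have [measurable]: "k \<in> borel_measurable borel" using D(1) by simp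
    show "(\<lambda>x. k (?e x)) \<in> borel_measurable ?P" by measurable
    show "PiE Basis (\<lambda>_. {- ?R..?R}) \<in> fmeasurable ?P"
      by (rule fmeasurable_PiE_Icc) simp
    fix x assume x: "x \<in> space ?P"
    show "0 \<le> k (?e x)" "k (?e x) \<le> C" using D(3,4) by auto
    assume "x \<notin> PiE Basis (\<lambda>_. {- ?R..?R})"
    then obtain j where j: "j \<in> Basis" "x j \<notin> {- ?R..?R}" using x by (auto simp: space_PiM PiE_iff)
    have "\<bar>x j\<bar> = \<bar>?e x \<bullet> j\<bar>" using j by simp
    also have "\<dots> \<le> norm (?e x)" using j by (intro Basis_le_norm)
    finally have "R < norm (?e x)" using j by auto
    then show "k (?e x) = 0" by (intro D(5)) auto
  qed
  show ?thesis unfolding eq[OF f] eq[OF g] eq[OF h]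
  proof (rule prekopa_leindler_PiM[OF finite_Basis u _ b[OF f] b[OF g] b[OF h]])
    fix x y :: "'a \<Rightarrow> real"
    have "?e (\<lambda>i\<in>Basis. u * x i + (1 - u) * y i) = u *\<^sub>R ?e x + (1 - u) *\<^sub>R ?e y"
      by (simp add: scaleR_sum_right scaleR_add_left sum.distrib)
    then show "f (?e x) powr u * g (?e y) powr (1 - u) \<le> h (?e (\<lambda>i\<in>Basis. u * x i + (1 - u) * y i))"
      using le[of "?e x" "?e y"] by (simp only:)
  qed simp
qed

section \<open>Convolution with the characteristic function of a convex body\<close>

lemma integral_lborel_scaleR:
  fixes k :: "'a::euclidean_space \<Rightarrow> real"
  assumes [measurable]: "k \<in> borel_measurable borel" and c: "c > 0"
  shows "(\<integral>y. k (c *\<^sub>R y) \<partial>lborel) = (\<integral>y. k y \<partial>lborel) / c ^ DIM('a)"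
proof -
  have "(\<integral>y. k y \<partial>lborel)
      = (\<integral>y. k y \<partial>density (distr lborel borel (\<lambda>x. 0 + c *\<^sub>R x)) (\<lambda>_. \<bar>c\<bar> ^ DIM('a)))"
    using c by (subst lborel_affine[of c 0]) auto
  also have "\<dots> = (\<integral>y. c ^ DIM('a) * k (c *\<^sub>R y) \<partial>lborel)"
    using c by (subst integral_density) (auto simp: integral_distr)
  finally show ?thesis using c by simp
qed

text \<open>For \<open>q > 0\<close> this says that \<open>f\<close> raised to the power \<open>1 / q\<close> is concave on \<open>{f > 0}\<close>: take
  \<open>a = f x powr (1 / q)\<close> and \<open>b = f y powr (1 / q)\<close>; the converse is the AM-GM inequality. Keeping \<open>a\<close> and
  \<open>b\<close> free makes the notion sensible for \<open>q = 0\<close> and lets it pass through convolutions by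
  the Prekopa-Leindler inequality alone.\<close>

definition power_concave :: "nat \<Rightarrow> ('a::real_vector \<Rightarrow> real) \<Rightarrow> bool" where
  "power_concave q f \<longleftrightarrow> (\<forall>x y a b l. 0 < a \<longrightarrow> 0 < b \<longrightarrow> 0 < l \<longrightarrow> l < 1 \<longrightarrow>
    (f x / a ^ q) powr (l * a / (l * a + (1 - l) * b))
      * (f y / b ^ q) powr (1 - l * a / (l * a + (1 - l) * b))
    \<le> f (l *\<^sub>R x + (1 - l) *\<^sub>R y) / (l * a + (1 - l) * b) ^ q)"

lemma power_concaveD:
  assumes f: "power_concave q f" and q: "0 < q" and pos: "0 < f x" "0 < f y" and l: "0 \<le> l" "l \<le> 1"
  shows "(l * f x powr (1 / real q) + (1 - l) * f y powr (1 / real q)) ^ q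
    \<le> f (l *\<^sub>R x + (1 - l) *\<^sub>R y)"
proof -
  have root: "(f z powr (1 / real q)) ^ q = f z" if "0 < f z" for z
    using q that by (simp add: powr_power)
  show ?thesis
  proof (cases "l = 0 \<or> l = 1")
    case True
    then show ?thesis using root pos by auto
  next
    case False
    let ?a = "f x powr (1 / real q)" and ?b = "f y powr (1 / real q)"
    have l': "0 < l" "l < 1" using False l by auto
    have s: "0 < l * ?a + (1 - l) * ?b" using pos l' by (intro add_pos_pos mult_pos_pos) auto
    \<comment> \<open>For these roots both bases on the left of the definition are 1, so the weights
      in the exponents disappear.\<close>
    have "1 \<le> f (l *\<^sub>R x + (1 - l) *\<^sub>R y) / (l * ?a + (1 - l) * ?b) ^ q"
      using f[unfolded power_concave_def, rule_format, of ?a ?b l x y] pos l' root by simp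
    then show ?thesis using s by (simp add: pos_le_divide_eq)
  qed
qed

text \<open>In degree 0 all denominators are 1, and the left-hand side is 1 if both points lie in
  \<open>S\<close> and 0 otherwise, so the claim is convexity. This starts the induction over the
  bodies.\<close>

lemma power_concave_indicator:
  fixes S :: "'a::real_vector set"
  assumes "convex S"
  shows "power_concave 0 (indicator S)"
  unfolding power_concave_def
proof (intro allI impI)
  fix x y :: 'a and a b l :: real
  assume "0 < a" "0 < b" and l: "0 < l" "l < 1"
  have "l *\<^sub>R x + (1 - l) *\<^sub>R y \<in> S" if "x \<in> S" "y \<in> S"
    using assms that l by (intro convexD) auto
  then show "(indicat_real S x / a ^ 0) powr (l * a / (l * a + (1 - l) * b))
      * (indicat_real S y / b ^ 0) powr (1 - l * a / (l * a + (1 - l) * b))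
    \<le> indicat_real S (l *\<^sub>R x + (1 - l) *\<^sub>R y) / (l * a + (1 - l) * b) ^ 0"
    by (auto simp: indicator_def)
qed

lemma bounded_on_support_cballI:
  fixes f :: "'a::euclidean_space \<Rightarrow> real"
  assumes "f \<in> borel_measurable borel" "\<And>x. 0 \<le> f x" "\<And>x. f x \<le> C" "\<And>x. f x \<noteq> 0 \<Longrightarrow> norm x \<le> R"
  shows "bounded_on_support lborel (cball 0 R) C f"
  using assms emeasure_lborel_cball_finite[of 0 R]
  by (auto simp: bounded_on_support_def fmeasurable_def)

lemma bounded_on_support_cballD:
  fixes f :: "'a::euclidean_space \<Rightarrow> real"
  assumes "bounded_on_support lborel (cball 0 R) C f"
  shows "f \<in> borel_measurable borel" "0 \<le> f x" "f x \<le> C" "f x \<noteq> 0 \<Longrightarrow> norm x \<le> R" "0 \<le> C"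
proof -
  note D = bounded_on_supportD[OF assms]
  show "f \<in> borel_measurable borel" "0 \<le> f x" "f x \<le> C" "f x \<noteq> 0 \<Longrightarrow> norm x \<le> R"
    using D(1,3,4) D(5)[of x] by (auto simp: dist_norm)
  show "0 \<le> C" using D(3)[of 0] D(4)[of 0] by auto
qed

section \<open>Convolving a bounded function with one convex body\<close>

context
  fixes f :: "'a::euclidean_space \<Rightarrow> real" and K :: "'a set" and R C :: real
  assumes f: "bounded_on_support lborel (cball 0 R) C f" and K: "compact K" "convex K"
begin

lemma bounded_on_support_conv_section:
  "bounded_on_support lborel (cball 0 R) C (\<lambda>y. f y * indicator K (x - y))"
proof -
  note [measurable] = bounded_on_support_cballD(1)[OF f] borel_compact[OF K(1)]
  show ?thesis
    using bounded_on_support_cballD(2)[OF f] bounded_on_support_cballD(3)[OF f] bounded_on_support_cballD(4)[OF f] bounded_on_support_cballD(5)[OF f]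
    by (intro bounded_on_support_cballI) (auto simp: indicator_def)
qed

lemma conv_indicator_nonneg: "0 \<le> convolution f (indicator K) x"
  unfolding convolution_def using bounded_on_support_integral_bounds(1)[OF bounded_on_support_conv_section] .

lemma conv_indicator_nonzeroE:
  assumes "convolution f (indicator K) x \<noteq> 0"
  obtains y where "f y \<noteq> 0" "x - y \<in> K"
proof -
  have "\<exists>y. f y * indicat_real K (x - y) \<noteq> 0"
    using assms unfolding convolution_def by (metis (no_types, lifting) Bochner_Integration.integral_zero Bochner_Integration.integral_cong)
  then show thesis using that by (auto simp: indicator_def split: if_splits)
qed

text \<open>Dominated convergence with majorant \<open>f\<close>: the indicator of \<open>K\<close>
  is locally constant off the frontier, and the frontier of a convex set is null.\<close>

lemma conv_indicator_continuous: "continuous_on UNIV (convolution f (indicator K))"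
proof -
  note [measurable] = bounded_on_support_cballD(1)[OF f] borel_compact[OF K(1)]
  have "(\<lambda>n. convolution f (indicator K) (X n)) \<longlonglongrightarrow> convolution f (indicator K) x"
    if X: "X \<longlonglongrightarrow> x" for X x
    unfolding convolution_def
  proof (rule integral_dominated_convergence[where w = f])
    show "integrable lborel f" by (rule bounded_on_support_integrable[OF f])
    have "negligible ((\<lambda>z. x - z) ` frontier K)"
      using K by (intro negligible_differentiable_image_negligible negligible_convex_frontier)
        (auto intro!: derivative_intros)
    moreover have "(\<lambda>z. x - z) ` frontier K = {y. x - y \<in> frontier K}"
      by (auto simp: image_iff intro!: bexI[of _ "x - _"])
    \<comment> \<open>Closedness makes the set Borel, so that negligibility, a statement about the
      completed measure, becomes nullity for \<open>lborel\<close>.\<close>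
    moreover have "closed {y. x - y \<in> frontier K}"
      using closed_vimage[of "frontier K" "\<lambda>y. x - y"] unfolding vimage_def
      by (simp add: continuous_on_diff)
    ultimately have "{y. x - y \<in> frontier K} \<in> null_sets lborel"
      by (metis (no_types, lifting) borel_closed negligible_iff_null_sets null_sets_completion_iff sets_lborel)
    then have "AE y in lborel. x - y \<notin> frontier K" by (auto dest: AE_not_in)
    then show "AE y in lborel. (\<lambda>n. f y * indicator K (X n - y)) \<longlonglongrightarrow> f y * indicator K (x - y)"
    proof eventually_elim
      case (elim y)
      have lim: "(\<lambda>n. X n - y) \<longlonglongrightarrow> x - y" by (intro tendsto_intros X)
      have "x - y \<in> interior K \<or> x - y \<in> - K"
        using elim closure_subset[of K] by (auto simp: frontier_def)
      then have "\<forall>\<^sub>F n in sequentially. indicat_real K (X n - y) = indicator K (x - y)"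
      proof
        assume "x - y \<in> interior K"
        then have "\<forall>\<^sub>F n in sequentially. X n - y \<in> interior K" using topological_tendstoD[OF lim] by auto
        then show ?thesis
          by eventually_elim (use \<open>x - y \<in> interior K\<close> interior_subset in \<open>auto simp: indicator_def\<close>)
      next
        assume "x - y \<in> - K"
        moreover have "open (- K)" using K by (simp add: compact_imp_closed open_Compl)
        ultimately have "\<forall>\<^sub>F n in sequentially. X n - y \<in> - K" using topological_tendstoD[OF lim] by blast
        then show ?thesis
          by eventually_elim (use \<open>x - y \<in> - K\<close> in \<open>auto simp: indicator_def\<close>)
      qed
      then have "(\<lambda>n. indicat_real K (X n - y)) \<longlonglongrightarrow> indicator K (x - y)" by (rule tendsto_eventually)
      then show ?case by (intro tendsto_intros)
    qed
    show "AE y in lborel. norm (f y * indicator K (X n - y)) \<le> f y" for n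
      using bounded_on_support_cballD(2)[OF f] by (auto simp: indicator_def)
  qed measurable
  then show ?thesis by (auto simp: continuous_on_sequentially comp_def)
qed

lemma bounded_on_support_conv_indicator:
  "\<exists>R' C'. bounded_on_support lborel (cball 0 R') C' (convolution f (indicator K))"
proof -
  obtain B where B: "\<And>z. z \<in> K \<Longrightarrow> norm z \<le> B"
    using compact_imp_bounded[OF K(1)] unfolding bounded_iff by blast
  have "bounded_on_support lborel (cball 0 (R + B)) (C * measure lborel (cball (0::'a) R)) (convolution f (indicator K))"
  proof (rule bounded_on_support_cballI)
    show "convolution f (indicator K) \<in> borel_measurable borel"
      by (rule borel_measurable_continuous_onI[OF conv_indicator_continuous])
    show "convolution f (indicator K) x \<le> C * measure lborel (cball (0::'a) R)" for x
      unfolding convolution_def using bounded_on_support_integral_bounds(2)[OF bounded_on_support_conv_section] .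
    fix x assume "convolution f (indicator K) x \<noteq> 0"
    then obtain y where "f y \<noteq> 0" "x - y \<in> K" by (rule conv_indicator_nonzeroE)
    then show "norm x \<le> R + B"
      using bounded_on_support_cballD(4)[OF f, of y] B[of "x - y"] norm_triangle_ineq[of y "x - y"] by simp
  qed (rule conv_indicator_nonneg)
  then show ?thesis by blast
qed

text \<open>Tonelli; for fixed \<open>y\<close> the integral over \<open>x\<close> is the volume of
  a translate of \<open>K\<close>.\<close>

lemma nn_integral_conv_indicator:
  "(\<integral>\<^sup>+x. ennreal (convolution f (indicator K) x) \<partial>lborel)
    = (\<integral>\<^sup>+x. ennreal (f x) \<partial>lborel) * ennreal (measure lborel K)"
proof -
  note [measurable] = bounded_on_support_cballD(1)[OF f] borel_compact[OF K(1)]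
  have mK: "emeasure lborel K = ennreal (measure lborel K)"
    using emeasure_bounded_finite[OF compact_imp_bounded[OF K(1)]]
    by (simp add: emeasure_eq_ennreal_measure less_top)
  have "(\<integral>\<^sup>+x. ennreal (convolution f (indicator K) x) \<partial>lborel)
      = (\<integral>\<^sup>+x. (\<integral>\<^sup>+y. ennreal (f y) * indicator K (x - y) \<partial>lborel) \<partial>lborel)"
  proof (rule nn_integral_cong)
    fix x
    have "ennreal (convolution f (indicator K) x) = (\<integral>\<^sup>+y. ennreal (f y * indicator K (x - y)) \<partial>lborel)"
      unfolding convolution_def
      by (intro nn_integral_eq_integral[symmetric] bounded_on_support_integrable[OF bounded_on_support_conv_section])
        (use bounded_on_support_cballD(2)[OF f] in auto)
    also have "\<dots> = (\<integral>\<^sup>+y. ennreal (f y) * indicator K (x - y) \<partial>lborel)"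
      by (intro nn_integral_cong) (auto simp: indicator_def)
    finally show "ennreal (convolution f (indicator K) x) = (\<integral>\<^sup>+y. ennreal (f y) * indicator K (x - y) \<partial>lborel)" .
  qed
  also have "\<dots> = (\<integral>\<^sup>+y. (\<integral>\<^sup>+x. ennreal (f y) * indicator K (x - y) \<partial>lborel) \<partial>lborel)"
    by (rule lborel_pair.Fubini'[symmetric]) measurable
  also have "\<dots> = (\<integral>\<^sup>+y. ennreal (f y) * ennreal (measure lborel K) \<partial>lborel)"
  proof (rule nn_integral_cong)
    fix y
    have eq: "(\<lambda>x. 1 *\<^sub>R x + y) ` K = {x. x - y \<in> K}" by (force simp: image_iff)
    have "(\<integral>\<^sup>+x. indicator K (x - y) \<partial>lborel) = (\<integral>\<^sup>+x. indicator {x. x - y \<in> K} x \<partial>lborel)"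
      by (intro nn_integral_cong) (auto simp: indicator_def)
    also have "\<dots> = emeasure lborel ((\<lambda>x. 1 *\<^sub>R x + y) ` K)" unfolding eq by (intro nn_integral_indicator) measurable
    also have "\<dots> = emeasure lborel K" by (subst emeasure_lborel_affine_image) auto
    finally have "(\<integral>\<^sup>+x. indicator K (x - y) \<partial>lborel) = emeasure lborel K" .
    then show "(\<integral>\<^sup>+x. ennreal (f y) * indicator K (x - y) \<partial>lborel) = ennreal (f y) * ennreal (measure lborel K)"
      by (subst nn_integral_cmult) (auto simp: mK)
  qed
  also have "\<dots> = (\<integral>\<^sup>+x. ennreal (f x) \<partial>lborel) * ennreal (measure lborel K)"
    by (rule nn_integral_multc) simp
  finally show ?thesis .
qed

text \<open>The integrand is positive on the open set \<open>?V\<close>, which contains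
  \<open>y\<close>. If the integral were 0, then \<open>?V\<close> would be null, but a nonempty
  open set is not.\<close>

lemma conv_indicator_pos:
  assumes U: "open U" "\<And>y. y \<in> U \<Longrightarrow> 0 < f y" and y: "y \<in> U" and z: "z \<in> interior K"
  shows "0 < convolution f (indicator K) (y + z)"
proof (rule ccontr)
  let ?g = "\<lambda>w. f w * indicator K (y + z - w)"
  let ?V = "U \<inter> (\<lambda>w. y + z - w) -` interior K"
  assume "\<not> ?thesis"
  then have "integral\<^sup>L lborel ?g = 0" using conv_indicator_nonneg[of "y + z"] by (simp add: convolution_def)
  then have "AE w in lborel. ?g w = 0"
    using bounded_on_support_integrable[OF bounded_on_support_conv_section] bounded_on_support_cballD(2)[OF f]
    by (subst (asm) integral_nonneg_eq_0_iff_AE) auto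
  moreover have "?g w \<noteq> 0" if "w \<in> ?V" for w
    using that U(2)[of w] interior_subset[of K] by (auto simp: indicator_def)
  ultimately have "AE w in lborel. w \<notin> ?V" by (auto elim: eventually_mono)
  moreover have oV: "open ?V" using U by (intro open_Int open_vimage continuous_intros) auto
  ultimately have "?V \<in> null_sets lborel"
    by (subst (asm) AE_iff_null_sets[symmetric]) auto
  then have "negligible ?V" by (simp add: negligible_iff_null_sets null_sets_completionI)
  then have "?V = {}" using open_not_negligible[OF oV] by auto
  then show False using y z by auto
qed

text \<open>Prekopa-Leindler is applied to rescaled integrands, with scales \<open>a\<close> at
  \<open>x\<close>, \<open>b\<close> at \<open>y\<close> and \<open>s\<close> at the intermediate
  point. The weight is \<open>u = l * a / s\<close> instead of \<open>l\<close>, because then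
  \<open>s\<close> times the \<open>u\<close>-combination of \<open>w\<close> and \<open>w'\<close>
  is the \<open>l\<close>-combination of \<open>a *\<^sub>R w\<close> and
  \<open>b *\<^sub>R w'\<close>. The concavity of \<open>f\<close> and the convexity of
  \<open>K\<close> at these points supply the pointwise hypothesis.\<close>

lemma power_concave_conv_indicator:
  assumes pc: "power_concave q f"
  shows "power_concave (q + DIM('a)) (convolution f (indicator K))"
  unfolding power_concave_def
proof (intro allI impI)
  note [measurable] = bounded_on_support_cballD(1)[OF f] borel_compact[OF K(1)]
  fix x y :: 'a and a b l :: real
  assume a: "0 < a" and b: "0 < b" and l: "0 < l" "l < 1"
  define s where "s = l * a + (1 - l) * b"
  define u where "u = l * a / s"
  have s: "s > 0" unfolding s_def using a b l by (intro add_pos_pos mult_pos_pos) auto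
  have us: "u * s = l * a" "(1 - u) * s = (1 - l) * b" using s by (auto simp: u_def s_def field_simps)
  have u: "0 < u" "u < 1" using a b l s by (auto simp: u_def s_def add_pos_pos mult_pos_pos)
  \<comment> \<open>The substitution \<open>w \<mapsto> c w\<close> contributes the missing factor \<open>c\<close> to the power \<open>DIM('a)\<close>.\<close>
  define G where "G = (\<lambda>v c w. f (c *\<^sub>R w) * indicator K (v - c *\<^sub>R w) / c ^ q)"
  \<comment> \<open>The sums provide one ball and one bound valid for all three scales.\<close>
  define R' where "R' = \<bar>R\<bar> / a + \<bar>R\<bar> / b + \<bar>R\<bar> / s"
  define C' where "C' = C / a ^ q + C / b ^ q + C / s ^ q"
  have G: "bounded_on_support lborel (cball 0 R') C' (G v c)"
    if c: "c \<in> {a, b, s}" for v c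
  proof (rule bounded_on_support_cballI)
    have c0: "c > 0" using c a b s by auto
    have C'c: "C / c ^ q \<le> C'" and R'c: "\<bar>R\<bar> / c \<le> R'"
      using c a b s bounded_on_support_cballD(5)[OF f] by (auto simp: C'_def R'_def)
    show "G v c \<in> borel_measurable borel" unfolding G_def by measurable
    show "0 \<le> G v c w" for w using bounded_on_support_cballD(2)[OF f] c0 by (auto simp: G_def)
    have "G v c w \<le> C / c ^ q" for w
      unfolding G_def using bounded_on_support_cballD(3)[OF f, of "c *\<^sub>R w"] bounded_on_support_cballD(5)[OF f] c0
      by (intro divide_right_mono) (auto simp: indicator_def)
    then show "G v c w \<le> C'" for w using C'c by (meson order_trans)
    fix w assume "G v c w \<noteq> 0"
    then have "c * norm w \<le> \<bar>R\<bar>" using bounded_on_support_cballD(4)[OF f, of "c *\<^sub>R w"] c0 by (auto simp: G_def)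
    then have "norm w \<le> \<bar>R\<bar> / c" using c0 by (simp add: pos_le_divide_eq mult.commute)
    then show "norm w \<le> R'" using R'c by linarith
  qed
  have int: "(\<integral>w. G v c w \<partial>lborel) = convolution f (indicator K) v / c ^ (q + DIM('a))" if c: "c > 0" for v c
    using integral_lborel_scaleR[of "\<lambda>w. f w * indicator K (v - w) / c ^ q" c] c
    by (simp add: G_def convolution_def power_add)
  have "(\<integral>w. G x a w \<partial>lborel) powr u * (\<integral>w. G y b w \<partial>lborel) powr (1 - u)
      \<le> (\<integral>w. G (l *\<^sub>R x + (1 - l) *\<^sub>R y) s w \<partial>lborel)"
  proof (rule prekopa_leindler[OF u G G G])
    fix w w' :: 'a
    have eq: "s *\<^sub>R (u *\<^sub>R w + (1 - u) *\<^sub>R w') = l *\<^sub>R (a *\<^sub>R w) + (1 - l) *\<^sub>R (b *\<^sub>R w')"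
      using us by (simp add: scaleR_add_right mult.commute[of s])
    show "G x a w powr u * G y b w' powr (1 - u)
        \<le> G (l *\<^sub>R x + (1 - l) *\<^sub>R y) s (u *\<^sub>R w + (1 - u) *\<^sub>R w')"
    proof (cases "x - a *\<^sub>R w \<in> K \<and> y - b *\<^sub>R w' \<in> K")
      case True
      then have "l *\<^sub>R (x - a *\<^sub>R w) + (1 - l) *\<^sub>R (y - b *\<^sub>R w') \<in> K"
        using l K(2) by (intro convexD) auto
      then have "l *\<^sub>R x + (1 - l) *\<^sub>R y - (l *\<^sub>R (a *\<^sub>R w) + (1 - l) *\<^sub>R (b *\<^sub>R w')) \<in> K"
        by (simp only: scaleR_diff_right diff_add_eq add_diff_add diff_diff_eq)
      then show ?thesis
        using True pc[unfolded power_concave_def, rule_format, OF a b l, of "a *\<^sub>R w" "b *\<^sub>R w'"]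
        unfolding G_def eq by (simp add: s_def u_def)
    next
      case False
      then have "G x a w powr u * G y b w' powr (1 - u) = 0" by (auto simp: G_def)
      moreover have "0 \<le> G (l *\<^sub>R x + (1 - l) *\<^sub>R y) s (u *\<^sub>R w + (1 - u) *\<^sub>R w')"
        using bounded_on_support_cballD(2)[OF f] s by (simp add: G_def)
      ultimately show ?thesis by linarith
    qed
  qed auto
  then show "(convolution f (indicator K) x / a ^ (q + DIM('a))) powr (l * a / (l * a + (1 - l) * b))
      * (convolution f (indicator K) y / b ^ (q + DIM('a))) powr (1 - l * a / (l * a + (1 - l) * b))
    \<le> convolution f (indicator K) (l *\<^sub>R x + (1 - l) *\<^sub>R y) / (l * a + (1 - l) * b) ^ (q + DIM('a))"
    unfolding int[OF a] int[OF b] int[OF s] by (simp add: u_def s_def)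
qed

end

section \<open>Iterated convolutions and Minkowski sums of several bodies\<close>

lemma chi_conv_Suc_0: "chi_conv (Suc 0) K = indicator (K 0)"
  by (simp add: chi_conv_def)

lemma chi_conv_Suc_Suc:
  "chi_conv (Suc (Suc k)) K = convolution (chi_conv (Suc k) K) (indicator (K (Suc k)))"
  by (simp add: chi_conv_def)

lemma open_set_plus_right:
  fixes S T :: "'a::real_normed_vector set"
  assumes "open T"
  shows "open (S + T)"
proof -
  have "S + T = (\<Union>x\<in>S. \<Union>y\<in>T. {x + y})" by (auto simp: set_plus_def)
  then show ?thesis using open_sums[of S T] assms by simp
qed

lemma compact_set_sum:
  fixes K :: "nat \<Rightarrow> 'a::real_normed_vector set"
  assumes "\<And>i. i < m \<Longrightarrow> compact (K i)"
  shows "compact (\<Sum>i<m. K i)"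
  using assms
proof (induction m)
  case (Suc m)
  have "(\<Sum>i<Suc m. K i) = {x + y | x y. x \<in> (\<Sum>i<m. K i) \<and> y \<in> K m}"
    by (auto simp: set_plus_def)
  then show ?case using compact_sums[of "\<Sum>i<m. K i" "K m"] Suc by simp
qed (simp add: set_zero)

text \<open>Used with \<open>L i = interior (K i)\<close>: the sum of the bodies then lies in the
  closure of the sum of their interiors, where the convolution is positive.\<close>

lemma set_sum_subset_closure:
  fixes K L :: "nat \<Rightarrow> 'a::real_normed_vector set"
  assumes "\<And>i. i < m \<Longrightarrow> K i \<subseteq> closure (L i)"
  shows "(\<Sum>i<m. K i) \<subseteq> closure (\<Sum>i<m. L i)"
  using assms
proof (induction m)
  case (Suc m)
  have "(\<Sum>i<m. K i) + K m \<subseteq> closure (\<Sum>i<m. L i) + closure (L m)"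
    using Suc by (intro set_plus_mono2) auto
  also have "\<dots> \<subseteq> closure ((\<Sum>i<m. L i) + L m)" by (rule closure_sum)
  finally show ?case by simp
qed (simp add: closure_subset)

lemma convex_body_closure_interior: "convex_body K \<Longrightarrow> closure (interior K) = K"
  unfolding convex_body_def by (simp add: convex_closure_interior compact_imp_closed)

text \<open>One simultaneous induction, as each step for the other properties relies on boundedness
  at the previous stage. The first indicator has degree 0 and each of the \<open>k\<close> further
  convolutions adds \<open>DIM('a)\<close>. The last two claims enclose the set where the
  convolution is positive between the sum of the interiors and the sum of the bodies.\<close>

lemma chi_conv_Suc:
  fixes K :: "nat \<Rightarrow> 'a::euclidean_space set"
  assumes "\<And>i. i \<le> k \<Longrightarrow> convex_body (K i)"
  shows "\<exists>R C. bounded_on_support lborel (cball 0 R) C (chi_conv (Suc k) K)" (is "?bdd k")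
    and "power_concave (k * DIM('a)) (chi_conv (Suc k) K)" (is "?conc k")
    and "(\<integral>\<^sup>+x. ennreal (chi_conv (Suc k) K x) \<partial>lborel) = ennreal (\<Prod>i<Suc k. measure lborel (K i))" (is "?int k")
    and "\<And>x. chi_conv (Suc k) K x \<noteq> 0 \<Longrightarrow> x \<in> (\<Sum>i<Suc k. K i)"
    and "\<And>x. x \<in> (\<Sum>i<Suc k. interior (K i)) \<Longrightarrow> 0 < chi_conv (Suc k) K x"
proof -
  have "?bdd k \<and> ?conc k \<and> ?int k \<and> (\<forall>x. chi_conv (Suc k) K x \<noteq> 0 \<longrightarrow> x \<in> (\<Sum>i<Suc k. K i))
    \<and> (\<forall>x\<in>(\<Sum>i<Suc k. interior (K i)). 0 < chi_conv (Suc k) K x)"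
    using assms
  proof (induction k)
    case 0
    have K: "compact (K 0)" "convex (K 0)" using 0 by (auto simp: convex_body_def)
    then have [measurable]: "K 0 \<in> sets borel" by (simp add: borel_compact)
    obtain B where "\<And>z. z \<in> K 0 \<Longrightarrow> norm z \<le> B"
      using compact_imp_bounded[OF K(1)] unfolding bounded_iff by blast
    then have "bounded_on_support lborel (cball 0 B) 1 (indicator (K 0))"
      by (intro bounded_on_support_cballI) (auto simp: indicator_def split: if_splits)
    moreover have "(\<integral>\<^sup>+x. ennreal (indicator (K 0) x) \<partial>lborel) = ennreal (measure lborel (K 0))"
      using emeasure_bounded_finite[OF compact_imp_bounded[OF K(1)]]
      by (simp add: ennreal_indicator emeasure_eq_ennreal_measure less_top)
    ultimately show ?case
      using power_concave_indicator[OF K(2)] interior_subset[of "K 0"]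
      by (auto simp: chi_conv_Suc_0 indicator_eq_0_iff subset_iff)
  next
    case (Suc k)
    let ?f = "chi_conv (Suc k) K" and ?K = "K (Suc k)"
    have IH: "?bdd k" "?conc k" "?int k" "\<And>x. ?f x \<noteq> 0 \<Longrightarrow> x \<in> (\<Sum>i<Suc k. K i)"
      "\<And>x. x \<in> (\<Sum>i<Suc k. interior (K i)) \<Longrightarrow> 0 < ?f x"
      using Suc.IH Suc.prems by auto
    obtain R C where f: "bounded_on_support lborel (cball 0 R) C ?f" using IH(1) by blast
    have K: "compact ?K" "convex ?K" using Suc.prems by (auto simp: convex_body_def)
    have 1: "?bdd (Suc k)"
      unfolding chi_conv_Suc_Suc by (rule bounded_on_support_conv_indicator[OF f K])
    have 2: "?conc (Suc k)"
      using power_concave_conv_indicator[OF f K IH(2)] by (simp add: chi_conv_Suc_Suc add.commute)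
    have 3: "?int (Suc k)"
      unfolding chi_conv_Suc_Suc nn_integral_conv_indicator[OF f K] IH(3)
      by (simp add: prod_nonneg flip: ennreal_mult)
    have 4: "x \<in> (\<Sum>i<Suc (Suc k). K i)" if nz: "chi_conv (Suc (Suc k)) K x \<noteq> 0" for x
    proof -
      obtain y where y: "?f y \<noteq> 0" "x - y \<in> ?K"
        using conv_indicator_nonzeroE[OF f K nz[unfolded chi_conv_Suc_Suc]] by blast
      have "y + (x - y) \<in> (\<Sum>i<Suc k. K i) + ?K"
        using IH(4)[OF y(1)] y(2) by (rule set_plus_intro)
      then show ?thesis by simp
    qed
    have 5: "0 < chi_conv (Suc (Suc k)) K x" if "x \<in> (\<Sum>i<Suc (Suc k). interior (K i))" for x
    proof -
      have "x \<in> (\<Sum>i<Suc k. interior (K i)) + interior ?K" using that by simp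
      then obtain y z where x: "x = y + z" and yz: "y \<in> (\<Sum>i<Suc k. interior (K i))" "z \<in> interior ?K"
        by (rule set_plus_elim)
      have "open (\<Sum>i<Suc k. interior (K i))" by (simp add: open_set_plus_right)
      then show ?thesis
        unfolding x chi_conv_Suc_Suc by (rule conv_indicator_pos[OF f K _ IH(5) yz])
    qed
    show ?case using 1 2 3 4 5 by blast
  qed
  then show "?bdd k" "?conc k" "?int k" "\<And>x. chi_conv (Suc k) K x \<noteq> 0 \<Longrightarrow> x \<in> (\<Sum>i<Suc k. K i)"
    "\<And>x. x \<in> (\<Sum>i<Suc k. interior (K i)) \<Longrightarrow> 0 < chi_conv (Suc k) K x" by blast+
qed

text \<open>The indicator of a single body jumps at the frontier; continuity comes from the last
  convolution, hence \<open>m \<ge> 2\<close>.\<close>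

lemma chi_conv_continuous:
  fixes K :: "nat \<Rightarrow> 'a::euclidean_space set"
  assumes "m \<ge> 2" "\<And>i. i < m \<Longrightarrow> convex_body (K i)"
  shows "continuous_on UNIV (chi_conv m K)"
proof -
  obtain k where m: "m = Suc (Suc k)" using assms(1) by (metis add_2_eq_Suc le_Suc_ex)
  obtain R C where "bounded_on_support lborel (cball 0 R) C (chi_conv (Suc k) K)"
    using chi_conv_Suc(1)[of k K] assms(2) m by auto
  then show ?thesis
    unfolding m chi_conv_Suc_Suc using assms(2)[of "Suc k"] m
    by (intro conv_indicator_continuous) (auto simp: convex_body_def)
qed

section \<open>Level sets of power-concave functions\<close>

lemma continuous_bounded_support_attains_max:
  fixes h :: "'a::euclidean_space \<Rightarrow> real"
  assumes "continuous_on UNIV h" "bounded_on_support lborel (cball 0 R) C h"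
  shows "\<exists>x0. \<forall>x. h x \<le> h x0"
proof -
  note D = bounded_on_supportD[OF assms(2)]
  \<comment> \<open>The absolute value keeps the ball nonempty. Outside it the function is 0, which
    is at most the maximum on the ball.\<close>
  have "\<exists>x0\<in>cball 0 \<bar>R\<bar>. \<forall>x\<in>cball 0 \<bar>R\<bar>. h x \<le> h x0"
    by (intro continuous_attains_sup continuous_on_subset[OF assms(1)]) auto
  then obtain x0 where x0: "\<And>x. x \<in> cball 0 \<bar>R\<bar> \<Longrightarrow> h x \<le> h x0" by blast
  have "h x \<le> h x0" for x
  proof (cases "x \<in> cball 0 \<bar>R\<bar>")
    case False
    then have "h x = 0" by (intro D(5)) auto
    then show ?thesis using D(3)[of x0] by simp
  qed (rule x0)
  then show ?thesis by blast
qed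

context
  fixes h :: "'a::euclidean_space \<Rightarrow> real" and p :: nat and x0 :: 'a
  assumes cont: "continuous_on UNIV h" and conc: "power_concave p h" and p: "0 < p"
    and max: "\<And>x. h x \<le> h x0" and pos: "0 < h x0"
begin

text \<open>Concavity of the \<open>p\<close>-th root of \<open>h\<close> on the segment from
  \<open>x0\<close> to \<open>x\<close> bounds that root below by
  \<open>1 - l * (1 - s powr (1 / p))\<close> times its value at \<open>x0\<close>. Taking
  \<open>s = 0\<close> uses only positivity at \<open>x\<close>; a positive \<open>s\<close>
  compares two level sets.\<close>

lemma level_set_shrink:
  assumes x: "0 < h x" "s * h x0 \<le> h x" and s: "0 \<le> s" and t: "0 < t"
    and l: "0 \<le> l" "l \<le> 1" "l * (1 - s powr (1 / real p)) \<le> 1 - t powr (1 / real p)"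
  shows "t * h x0 \<le> h (x0 + l *\<^sub>R (x - x0))"
proof -
  let ?r = "\<lambda>y. y powr (1 / real p)"
  have root: "?r y ^ p = y" if "0 < y" for y using p that by (simp add: powr_power)
  have "?r s * ?r (h x0) \<le> ?r (h x)"
    using x s pos p by (subst powr_mult[symmetric]) (auto intro!: powr_mono2)
  then have "l * (?r s * ?r (h x0)) \<le> l * ?r (h x)" using l by (intro mult_left_mono)
  moreover have "?r t * ?r (h x0) \<le> (1 - l * (1 - ?r s)) * ?r (h x0)"
    using l by (intro mult_right_mono) auto
  ultimately have *: "?r t * ?r (h x0) \<le> l * ?r (h x) + (1 - l) * ?r (h x0)"
    by (simp add: algebra_simps)
  have "t * h x0 = (?r t * ?r (h x0)) ^ p" using root t pos by (simp add: power_mult_distrib)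
  also have "\<dots> \<le> (l * ?r (h x) + (1 - l) * ?r (h x0)) ^ p" using * by (intro power_mono) auto
  also have "\<dots> \<le> h (l *\<^sub>R x + (1 - l) *\<^sub>R x0)" by (rule power_concaveD[OF conc p x(1) pos l(1,2)])
  also have "l *\<^sub>R x + (1 - l) *\<^sub>R x0 = x0 + l *\<^sub>R (x - x0)" by (simp add: algebra_simps)
  finally show ?thesis .
qed

lemma closed_level_set: "closed {x. t \<le> h x}"
  using closed_Collect_le[OF continuous_on_const cont] .

text \<open>The homothety with centre \<open>x0\<close> and ratio \<open>1 - t powr (1 / p)\<close>
  maps \<open>{x. 0 < h x}\<close> into the level set by the previous estimate with
  \<open>s = 0\<close>. The level set is closed, so this extends to the closure.\<close>

lemma level_set_superset:
  assumes S: "S \<subseteq> closure {x. 0 < h x}" and t: "0 < t" "t < 1"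
  shows "(\<lambda>x. (1 - t powr (1 / real p)) *\<^sub>R x + (t powr (1 / real p)) *\<^sub>R x0) ` S \<subseteq> {x. t * h x0 \<le> h x}"
proof -
  let ?c = "t powr (1 / real p)"
  let ?T = "\<lambda>x. (1 - ?c) *\<^sub>R x + ?c *\<^sub>R x0"
  have c: "0 \<le> ?c" "?c \<le> 1" using t by (auto intro: powr_le1)
  have "?T ` {x. 0 < h x} \<subseteq> {x. t * h x0 \<le> h x}"
  proof safe
    fix x assume "0 < h x"
    then have "t * h x0 \<le> h (x0 + (1 - ?c) *\<^sub>R (x - x0))"
      using t c by (intro level_set_shrink[where s = 0]) auto
    also have "x0 + (1 - ?c) *\<^sub>R (x - x0) = ?T x" by (simp add: algebra_simps)
    finally show "t * h x0 \<le> h (?T x)" .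
  qed
  then have "?T ` closure {x. 0 < h x} \<subseteq> {x. t * h x0 \<le> h x}"
    by (intro image_closure_subset closed_level_set continuous_intros)
  then show ?thesis using S by blast
qed

text \<open>The layer cake formula for \<open>h / h x0\<close>: levels above 1 are empty because
  \<open>h x0\<close> is the maximum, and level 0 is a null set.\<close>

lemma nn_integral_level_sets:
  "(\<integral>\<^sup>+x. ennreal (h x / h x0) \<partial>lborel)
    = (\<integral>\<^sup>+t. emeasure lborel {x. t * h x0 \<le> h x} * indicator {0..1} t \<partial>lborel)"
proof -
  have [measurable]: "h \<in> borel_measurable borel" by (rule borel_measurable_continuous_onI[OF cont])
  have eq: "{x. t \<le> h x / h x0} = {x. t * h x0 \<le> h x}" for t using pos by (simp add: pos_le_divide_eq)
  have "AE t in lborel. t \<noteq> (0::real)" by (rule AE_lborel_singleton)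
  then have "AE t in lborel. emeasure lborel {x. t * h x0 \<le> h x} * indicator {0<..} t
      = emeasure lborel {x. t * h x0 \<le> h x} * indicator {0..1} t"
  proof eventually_elim
    case (elim t)
    have "{x. t * h x0 \<le> h x} = {}" if "1 < t"
    proof -
      have "h x < t * h x0" for x
        using max[of x] that pos by (smt (verit) mult_less_cancel_right1)
      then show ?thesis by (auto simp: not_le)
    qed
    then show ?case using elim by (auto simp: indicator_def)
  qed
  then show ?thesis
    by (subst nn_integral_layer_cake) (auto simp: eq intro: nn_integral_cong_AE)
qed

text \<open>Each level set contains a copy of \<open>S\<close> scaled by
  \<open>1 - t powr (1 / p)\<close>; integrating the volumes over \<open>t\<close> produces the Beta
  integral.\<close>

lemma emeasure_closure_support_le:
  assumes S: "S \<subseteq> closure {x. 0 < h x}" "S \<in> sets borel"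
  shows "emeasure lborel S * ennreal (1 / real ((p + DIM('a)) choose DIM('a)))
    \<le> (\<integral>\<^sup>+x. ennreal (h x / h x0) \<partial>lborel)"
proof -
  have "emeasure lborel S * ennreal (1 / real ((p + DIM('a)) choose DIM('a)))
      = (\<integral>\<^sup>+t. emeasure lborel S * (ennreal ((1 - t powr (1 / real p)) ^ DIM('a)) * indicator {0..1} t) \<partial>lborel)"
    unfolding nn_integral_power_beta[OF p, symmetric] by (rule nn_integral_cmult[symmetric]) measurable
  also have "\<dots> \<le> (\<integral>\<^sup>+t. emeasure lborel {x. t * h x0 \<le> h x} * indicator {0..1} t \<partial>lborel)"
  proof (rule nn_integral_mono_AE)
    have "AE t in lborel. t \<noteq> (0::real)" "AE t in lborel. t \<noteq> (1::real)" by (rule AE_lborel_singleton)+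
    then show "AE t in lborel. emeasure lborel S * (ennreal ((1 - t powr (1 / real p)) ^ DIM('a)) * indicator {0..1} t)
        \<le> emeasure lborel {x. t * h x0 \<le> h x} * indicator {0..1} t"
    proof eventually_elim
      case (elim t)
      show ?case
      proof (cases "t \<in> {0..1}")
        case True
        then have t: "0 < t" "t < 1" using elim by auto
        let ?c = "1 - t powr (1 / real p)"
        have c: "?c > 0" using t p powr_less_mono2[of "1 / real p" t 1] by simp
        have "ennreal (?c ^ DIM('a)) * emeasure lborel S
            = emeasure lborel ((\<lambda>x. ?c *\<^sub>R x + (t powr (1 / real p)) *\<^sub>R x0) ` S)"
          using c S by (subst emeasure_lborel_affine_image) auto
        also have "\<dots> \<le> emeasure lborel {x. t * h x0 \<le> h x}"
          using level_set_superset[OF S(1) t] closed_level_set by (intro emeasure_mono) auto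
        finally show ?thesis using True by (simp add: mult.commute)
      qed simp
    qed
  qed
  also have "\<dots> = (\<integral>\<^sup>+x. ennreal (h x / h x0) \<partial>lborel)" by (rule nn_integral_level_sets[symmetric])
  finally show ?thesis .
qed

text \<open>The reverse estimate: each level set is contained in a scaled copy of \<open>D\<close>.
  It is stated with \<open>emeasure\<close> because \<open>D\<close> may have infinite
  volume.\<close>

lemma nn_integral_le_emeasure_rescaled_level_sets:
  assumes D: "D \<in> sets borel"
    and sub: "\<And>t. 0 < t \<Longrightarrow> t < 1 \<Longrightarrow> (\<lambda>x. x /\<^sub>R (1 - t powr (1 / real p))) ` {x. t * h x0 \<le> h x} \<subseteq> D"
  shows "(\<integral>\<^sup>+x. ennreal (h x / h x0) \<partial>lborel)
    \<le> emeasure lborel D * ennreal (1 / real ((p + DIM('a)) choose DIM('a)))"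
proof -
  have "(\<integral>\<^sup>+x. ennreal (h x / h x0) \<partial>lborel)
      = (\<integral>\<^sup>+t. emeasure lborel {x. t * h x0 \<le> h x} * indicator {0..1} t \<partial>lborel)"
    by (rule nn_integral_level_sets)
  also have "\<dots> \<le> (\<integral>\<^sup>+t. emeasure lborel D * (ennreal ((1 - t powr (1 / real p)) ^ DIM('a)) * indicator {0..1} t) \<partial>lborel)"
  proof (rule nn_integral_mono_AE)
    have "AE t in lborel. t \<noteq> (0::real)" "AE t in lborel. t \<noteq> (1::real)" by (rule AE_lborel_singleton)+
    then show "AE t in lborel. emeasure lborel {x. t * h x0 \<le> h x} * indicator {0..1} t
        \<le> emeasure lborel D * (ennreal ((1 - t powr (1 / real p)) ^ DIM('a)) * indicator {0..1} t)"
    proof eventually_elim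
      case (elim t)
      show ?case
      proof (cases "t \<in> {0..1}")
        case True
        then have t: "0 < t" "t < 1" using elim by auto
        let ?c = "1 - t powr (1 / real p)"
        have c: "?c > 0" using t p powr_less_mono2[of "1 / real p" t 1] by simp
        have "{x. t * h x0 \<le> h x} \<subseteq> (\<lambda>x. ?c *\<^sub>R x + 0) ` D"
        proof
          fix x assume "x \<in> {x. t * h x0 \<le> h x}"
          then have "x /\<^sub>R ?c \<in> D" using sub[OF t] by blast
          then show "x \<in> (\<lambda>x. ?c *\<^sub>R x + 0) ` D" using c by (intro image_eqI[of _ _ "x /\<^sub>R ?c"]) auto
        qed
        then have "emeasure lborel {x. t * h x0 \<le> h x} \<le> emeasure lborel ((\<lambda>x. ?c *\<^sub>R x + 0) ` D)"
          using sets_borel_affine_image[OF D, of ?c 0] c by (intro emeasure_mono) auto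
        also have "\<dots> = ennreal (?c ^ DIM('a)) * emeasure lborel D"
          using c D by (subst emeasure_lborel_affine_image) auto
        finally show ?thesis using True by (simp add: mult.commute)
      qed simp
    qed
  qed
  also have "\<dots> = emeasure lborel D * ennreal (1 / real ((p + DIM('a)) choose DIM('a)))"
    unfolding nn_integral_power_beta[OF p, symmetric] by (rule nn_integral_cmult) measurable
  finally show ?thesis .
qed

end

section \<open>Volume of the Minkowski sum\<close>

theorem corollary5p9:
  fixes K :: "nat \<Rightarrow> (real ^ 'n) set" and m :: nat
  assumes "m \<ge> 2"
    and "\<And>i. i < m \<Longrightarrow> convex_body (K i)"
  shows "measure lborel (\<Sum>i<m. K i)
      \<le> real ((m * CARD('n)) choose CARD('n)) * (\<Prod>i<m. measure lborel (K i)) / conv_max m K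
    \<and> (conv_max m K = chi_conv m K 0 \<longrightarrow>
        ennreal (real ((m * CARD('n)) choose CARD('n)) * (\<Prod>i<m. measure lborel (K i)) / conv_max m K)
        \<le> ennreal ((real m - 1) ^ CARD('n) * real CARD('n) ^ CARD('n)) * emeasure lborel (C1 m K))"
proof -
  obtain k where m: "m = Suc k" and k: "k \<ge> 1" using assms(1) by (cases m) auto
  define h where "h = chi_conv m K"
  define n where "n = CARD('n)"
  define p where "p = k * n"
  define S where "S = (\<Sum>i<m. K i)"
  define V where "V = (\<Prod>i<m. measure lborel (K i))"
  define b where "b = real ((m * n) choose n)"
  have cb: "\<And>i. i \<le> k \<Longrightarrow> convex_body (K i)" using assms(2) m by auto
  note H = chi_conv_Suc[of k K, OF cb, folded m, folded h_def]
  have n: "0 < n" by (simp add: n_def)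
  have p: "0 < p" using k n by (simp add: p_def)
  \<comment> \<open>This turns the Beta constant \<open>(p + n) choose n\<close> into the binomial
    coefficient of the theorem.\<close>
  have pn: "p + n = m * n" by (simp add: p_def m)
  have b: "0 < b" unfolding b_def using m by (simp del: mult_Suc)
  have cont: "continuous_on UNIV h" unfolding h_def by (rule chi_conv_continuous[OF assms])
  have conc: "power_concave p h" using H(2) by (simp add: p_def n_def)
  obtain x0 where x0: "\<And>x. h x \<le> h x0"
    using H(1) continuous_bounded_support_attains_max[OF cont] by blast
  \<comment> \<open>\<open>GREATEST\<close> has its intended value only because the maximum is
    attained, at \<open>x0\<close>.\<close>
  have M: "conv_max m K = h x0"
    unfolding conv_max_def h_def[symmetric] using x0 by (intro Greatest_equality) auto
  have S_closure: "S \<subseteq> closure {x. 0 < h x}"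
  proof -
    have "S \<subseteq> closure (\<Sum>i<m. interior (K i))"
      unfolding S_def using assms(2) by (intro set_sum_subset_closure) (simp add: convex_body_closure_interior)
    also have "\<dots> \<subseteq> closure {x. 0 < h x}" using H(5) by (intro closure_mono) auto
    finally show ?thesis .
  qed
  have compact: "compact S"
    unfolding S_def using assms(2) by (intro compact_set_sum) (auto simp: convex_body_def)
  \<comment> \<open>As \<open>S\<close> lies in the closure of \<open>{x. 0 < h x}\<close>, this
    makes \<open>h\<close> positive somewhere and hence the maximum positive.\<close>
  have "S \<noteq> {}"
  proof -
    have "\<exists>x. x \<in> (\<Sum>i<j. K i)" if "j \<le> m" for j
      using that
    proof (induction j)
      case (Suc j)
      moreover obtain y where "y \<in> K j"
        using assms(2)[of j] Suc.prems interior_subset[of "K j"] unfolding convex_body_def by fastforce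
      ultimately show ?case by (auto intro: set_plus_intro)
    qed (simp add: set_zero)
    then show ?thesis by (auto simp: S_def)
  qed
  then have pos: "0 < h x0" using S_closure x0 by (smt (verit) closure_empty Collect_empty_eq subset_empty)
  have V: "V \<ge> 0" unfolding V_def by (intro prod_nonneg) auto
  have [measurable]: "h \<in> borel_measurable borel" by (rule borel_measurable_continuous_onI[OF cont])
  have int: "(\<integral>\<^sup>+x. ennreal (h x / h x0) \<partial>lborel) = ennreal (V / h x0)"
  proof -
    obtain R C where "bounded_on_support lborel (cball 0 R) C h" using H(1) by blast
    note nonneg = bounded_on_supportD(3)[OF this]
    have "(\<integral>\<^sup>+x. ennreal (h x / h x0) \<partial>lborel) = (\<integral>\<^sup>+x. ennreal (h x) * ennreal (1 / h x0) \<partial>lborel)"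
      using nonneg pos by (intro nn_integral_cong) (auto simp flip: ennreal_mult)
    also have "\<dots> = ennreal V * ennreal (1 / h x0)"
      using H(3) by (subst nn_integral_multc) (auto simp: V_def)
    finally show ?thesis using V pos by (simp flip: ennreal_mult)
  qed

  \<comment> \<open>Upper bound for the volume of the Minkowski sum\<close>
  have first: "measure lborel S \<le> b * V / h x0"
  proof -
    have mS: "emeasure lborel S = ennreal (measure lborel S)"
      using emeasure_bounded_finite[OF compact_imp_bounded[OF compact]]
      by (simp add: emeasure_eq_ennreal_measure less_top)
    have "emeasure lborel S * ennreal (1 / b) \<le> ennreal (V / h x0)"
      using emeasure_closure_support_le[OF cont conc p x0 pos S_closure] compact
      by (simp add: int b_def n_def borel_compact pn[unfolded n_def])
    then have "ennreal (measure lborel S * (1 / b)) \<le> ennreal (V / h x0)"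
      unfolding mS using b by (subst ennreal_mult) auto
    then have "measure lborel S * (1 / b) \<le> V / h x0"
      using V pos by (subst (asm) ennreal_le_iff) auto
    then show ?thesis using b pos by (simp add: field_simps)
  qed

  \<comment> \<open>Lower bound for the volume of the limit body\<close>
  have second: "ennreal (b * V / h x0) \<le> ennreal ((real m - 1) ^ n * real n ^ n) * emeasure lborel (C1 m K)"
    if "h x0 = h 0"
  proof -
    have max0: "\<And>x. h x \<le> h 0" and pos0: "0 < h 0" using x0 pos that by auto
    define B where "B = (\<lambda>\<theta>. (\<lambda>x. x /\<^sub>R (1 - \<theta> powr (1 / real p))) ` theta_sum \<theta> m K)"
    have P: "(real m - 1) * real CARD('n) = real p" by (simp add: p_def m n_def)
    \<comment> \<open>For positive \<theta> the inequality forces \<open>h x\<close> to be nonzero,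
      and the convolution vanishes outside the Minkowski sum.\<close>
    have level: "theta_sum \<theta> m K = {x. \<theta> * h 0 \<le> h x}" if "0 < \<theta>" for \<theta>
    proof -
      have "x \<in> S" if "\<theta> * h 0 \<le> h x" for x
      proof -
        have "h x \<noteq> 0" using that pos0 \<open>0 < \<theta>\<close> by (smt (verit) mult_pos_pos)
        then show ?thesis using H(4) by (simp add: S_def)
      qed
      then show ?thesis unfolding theta_sum_def M \<open>h x0 = h 0\<close> by (auto simp: h_def S_def)
    qed
    have c: "0 < 1 - t powr (1 / real p)" if "0 < t" "t < 1" for t
      using that p powr_less_mono2[of "1 / real p" t 1] by simp
    \<comment> \<open>Shrinking \<open>x\<close> towards the maximum point 0 by the factor
      \<open>?ct / ?cs\<close> turns the last condition of \<open>level_set_shrink\<close> into an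
      equality and lands in level \<open>t\<close>; dividing by \<open>?ct\<close> gives back
      \<open>z\<close>.\<close>
    have mono: "B s \<subseteq> B t" if st: "0 < s" "s \<le> t" "t < 1" for s t
    proof
      fix z assume "z \<in> B s"
      then obtain x where z: "z = x /\<^sub>R (1 - s powr (1 / real p))" and x: "s * h 0 \<le> h x"
        using st level by (auto simp: B_def)
      let ?cs = "1 - s powr (1 / real p)" and ?ct = "1 - t powr (1 / real p)"
      have cs: "0 < ?cs" and ct: "0 < ?ct" using c st by auto
      have "?ct \<le> ?cs" using st by (simp add: powr_mono2)
      moreover have "0 < h x" using x st pos0 by (smt (verit) mult_pos_pos)
      ultimately have "t * h 0 \<le> h (0 + (?ct / ?cs) *\<^sub>R (x - 0))"
        using st x cs ct by (intro level_set_shrink[OF cont conc p max0 pos0, where s = s]) auto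
      then have "(?ct / ?cs) *\<^sub>R x \<in> theta_sum t m K" using level st by auto
      moreover have "z = ((?ct / ?cs) *\<^sub>R x) /\<^sub>R ?ct" using ct by (simp add: z divide_inverse)
      ultimately show "z \<in> B t" unfolding B_def by blast
    qed
    define D where "D = closure (\<Union>\<theta>\<in>{0<..<1}. B \<theta>)"
    have C1: "C1 m K = (\<lambda>x. (1 / real p) *\<^sub>R x + 0) ` D"
      using C1_eq_closure_Union[OF assms(1), of K, unfolded P, OF mono[unfolded B_def], folded B_def, folded D_def]
      by (simp add: inverse_eq_divide)
    have Db: "D \<in> sets borel" by (simp add: D_def)
    have "ennreal (V / h 0) \<le> emeasure lborel D * ennreal (1 / b)"
    proof -
      have "(\<lambda>x. x /\<^sub>R (1 - t powr (1 / real p))) ` {x. t * h 0 \<le> h x} \<subseteq> D" if "0 < t" "t < 1" for t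
      proof -
        have "B t \<subseteq> (\<Union>\<theta>\<in>{0<..<1}. B \<theta>)" using that by auto
        also have "\<dots> \<subseteq> D" unfolding D_def by (rule closure_subset)
        finally show ?thesis unfolding B_def level[OF that(1)] .
      qed
      from nn_integral_le_emeasure_rescaled_level_sets[OF cont conc p max0 pos0 Db this]
      show ?thesis using int that by (simp add: b_def n_def pn[unfolded n_def])
    qed
    \<comment> \<open>\<open>D\<close> may have infinite volume, so \<open>b\<close> is brought in
      by multiplication in \<open>ennreal\<close> and cancelled against
      \<open>1 / b\<close>.\<close>
    then have "ennreal b * ennreal (V / h 0) \<le> ennreal b * (emeasure lborel D * ennreal (1 / b))"
      by (intro mult_left_mono) auto
    also have "\<dots> = emeasure lborel D * (ennreal b * ennreal (1 / b))" by (simp add: mult_ac)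
    also have "ennreal b * ennreal (1 / b) = 1" using b by (simp flip: ennreal_mult)
    \<comment> \<open>\<open>C1\<close> is \<open>D\<close> scaled by \<open>1 / p\<close>, so
      \<open>p ^ n\<close> undoes the volume factor; with \<open>p = (m - 1) n\<close> it becomes
      the stated constant.\<close>
    also have "emeasure lborel D * 1 = ennreal (real p ^ n) * emeasure lborel (C1 m K)"
    proof -
      have "emeasure lborel (C1 m K) = ennreal ((1 / real p) ^ n) * emeasure lborel D"
        unfolding C1 using Db p by (subst emeasure_lborel_affine_image) (auto simp: n_def)
      moreover have "ennreal (real p ^ n) * ennreal ((1 / real p) ^ n) = 1"
        using p by (simp add: power_one_over flip: ennreal_mult)
      ultimately show ?thesis by (simp add: mult.assoc[symmetric])
    qed
    also have "real p ^ n = (real m - 1) ^ n * real n ^ n"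
      by (simp add: p_def m power_mult_distrib)
    also have "ennreal b * ennreal (V / h 0) = ennreal (b * V / h x0)"
      using b V pos0 that by (simp flip: ennreal_mult)
    finally show ?thesis .
  qed
  show ?thesis
    using first second unfolding M S_def V_def b_def n_def h_def by blast
qed

end
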